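(* Assume the setting below, and suppose the reduced solution $u_0$ is a linear function. On the A-mesh $S_{1/\varepsilon}$ (i.e. $\lambda=\varepsilon^{-1}$) with mesh parameter $a\ge4$, let $U^N$ be the solution of $U^N_0=0$, $L^NU^N_i=f(x_i)$ for $1\le i\le N-1$, $U^N_N=0$. There exist $N_0$ and $C$, both independent of $\varepsilon$, such that for all $N\ge N_0$, \[ \|u^N-U^N\|\le C\max\left\{\varepsilon|\ln\varepsilon|^3N^{-2},\ \varepsilon N^{-2}+\varepsilon^2N^{-1}\right\}. \]
   Context: Let $0<\varepsilon<1$. Let $b,c,f\in C^4[0,1]$, and let $\beta$ be a constant with $b(x)>\beta>0$ and $c(x)\ge0$ on $[0,1]$. Let $u$ be the solution of $-\varepsilon u''-bu'+cu=f$ on $(0,1)$ with $u(0)=u(1)=0$. The reduced solution $u_0$ is the solution of $-bu_0'+cu_0=f$ on $(0,1)$ with $u_0(1)=0$. Mesh $S_\lambda$, $\lambda\in\{N,\varepsilon^{-1}\}$. $N$ is a positive integer. $Q\in(0,1)$ is a fixed rational with $J=QN$ an integer, and $a>0$. Set $\xi=(a\varepsilon/\beta)\ln\lambda$, assumed $\le Q$, and $h=\xi/J$, $H=(1-\xi)/(N-J)$. The mesh points are $x_i=ih$ ($0\le i\le J$) and $x_i=\xi+(i-J)H$ ($J\le i\le N$). Write $h_i=x_i-x_{i-1}$ and $\hbar_i=(h_i+h_{i+1})/2$. Scheme. $D^+U_i=(U_{i+1}-U_i)/h_{i+1}$, $D^-U_i=(U_i-U_{i-1})/h_i$, $D''U_i=(D^+U_i-D^-U_i)/\hbar_i$.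 Let $\sigma(\rho)=2\rho/(e^{2\rho}-1)$ for $\rho>0$, $\sigma(0)=1$, and $\rho_i=b(x_i)h_{i+1}/(2\varepsilon)$. The ASI operator is $L^NU_i=-\varepsilon\sigma(\rho_i)D''U_i-b(x_i)D^+U_i+c(x_i)U_i$. $u^N$ is the restriction of $u$ to the mesh, and $\|U\|=\max_i|U_i|$. *)

theory Defs
  imports "HOL-Analysis.Analysis"
begin

definition C4_01 :: "(real \<Rightarrow> real) \<Rightarrow> bool" where
  "C4_01 g \<longleftrightarrow> (\<exists>d :: nat \<Rightarrow> real \<Rightarrow> real. d 0 = g \<and>
     (\<forall>k<4. \<forall>x\<in>{0..1}. (d k has_real_derivative d (Suc k) x) (at x within {0..1})) \<and>
     continuous_on {0..1} (d 4))"

definition is_bvp_solution ::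
  "real \<Rightarrow> (real \<Rightarrow> real) \<Rightarrow> (real \<Rightarrow> real) \<Rightarrow> (real \<Rightarrow> real) \<Rightarrow> (real \<Rightarrow> real) \<Rightarrow> bool" where
  "is_bvp_solution eps b c f u \<longleftrightarrow>
     continuous_on {0..1} u \<and> u 0 = 0 \<and> u 1 = 0 \<and>
     (\<exists>u' u''. \<forall>x\<in>{0<..<1}. (u has_real_derivative u' x) (at x) \<and>
        (u' has_real_derivative u'' x) (at x) \<and>
        - eps * u'' x - b x * u' x + c x * u x = f x)"

text \<open>The reduced solution u0 (solving -b u0' + c u0 = f on (0,1), u0(1)=0) is linear:
  u0 x = p x + q. By uniqueness of the reduced solution this is the same as saying
  the reduced solution is a linear function.\<close>
definition reduced_solution_linear ::
  "(real \<Rightarrow> real) \<Rightarrow> (real \<Rightarrow> real) \<Rightarrow> (real \<Rightarrow> real) \<Rightarrow> bool" where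
  "reduced_solution_linear b c f \<longleftrightarrow>
     (\<exists>p q :: real. p * 1 + q = 0 \<and>
        (\<forall>x\<in>{0<..<1}. - b x * p + c x * (p * x + q) = f x))"

definition mesh_xi :: "real \<Rightarrow> real \<Rightarrow> real \<Rightarrow> real \<Rightarrow> real" where
  "mesh_xi a eps beta lam = (a * eps / beta) * ln lam"

text \<open>Mesh S_lambda with N intervals, J = QN fine intervals.\<close>
definition mesh_pt :: "real \<Rightarrow> real \<Rightarrow> real \<Rightarrow> real \<Rightarrow> nat \<Rightarrow> nat \<Rightarrow> nat \<Rightarrow> real" where
  "mesh_pt a eps beta lam N J i =
     (let xi = mesh_xi a eps beta lam; h = xi / real J; H = (1 - xi) / (real N - real J)
      in if i \<le> J then real i * h else xi + (real i - real J) * H)"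

definition sigma :: "real \<Rightarrow> real" where
  "sigma \<rho> = (if \<rho> = 0 then 1 else 2 * \<rho> / (exp (2 * \<rho>) - 1))"

definition ASI_op ::
  "real \<Rightarrow> (real \<Rightarrow> real) \<Rightarrow> (real \<Rightarrow> real) \<Rightarrow> (nat \<Rightarrow> real) \<Rightarrow> (nat \<Rightarrow> real) \<Rightarrow> nat \<Rightarrow> real" where
  "ASI_op eps b c x U i =
     (let hi = x i - x (i - 1); hi1 = x (i + 1) - x i; hbar = (hi + hi1) / 2;
          Dp = (U (i + 1) - U i) / hi1; Dm = (U i - U (i - 1)) / hi;
          D2 = (Dp - Dm) / hbar; \<rho> = b (x i) * hi1 / (2 * eps)
      in - eps * sigma \<rho> * D2 - b (x i) * Dp + c (x i) * U i)"

end

(*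
  Subtracting the linear reduced solution u0, on which the scheme is exact, leaves a layer function
  v with - eps v'' - b v' + c v = 0 and |v^(k)| <= C eps^(-k) E, where E(x) = exp(- beta x / eps).
  Freezing b at a node, the exponentially fitted difference operator is an average of the operator
  - eps w'' - b(x_i) w' over the stencil: it is exact on constants and on exp(- b(x_i) t / eps) and it
  preserves sign. So only (b - b(x_i)) v' - (c v - c(x_i) v(x_i)) enters the truncation error, which on
  the fine mesh is O(eta^2 / (1 + eta)) E(x_i) with eta = h / eps; this saves a power of eps against plain Taylor
  expansion. As eps E(x_i) is a discrete barrier for that term, the fine mesh contributes
  O(eps eta^2) = O(eps |ln eps|^2 / N^2). On the coarse mesh a >= 4 gives E <= eps^4, so the first-order
  truncation error there is O(eps^2 / N) up to terms in eps eta^2, and a linear barrier finishes.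
*)

theory Submission
  imports Defs
begin

section \<open>The exponentially fitted difference operator\<close>

text \<open>The obstacle is that \<open>h / \<epsilon>\<close> is not bounded: it is a fixed
  multiple of \<open>ln (1 / \<epsilon>) / N\<close>, so for fixed \<open>N\<close> it grows as
  \<open>\<epsilon>\<close> tends to 0. Taylor expansion over a fine step then fails, and the
  barrier loses strength as well. The cure is to give the truncation bound and the barrier the same
  factor \<open>1 / (1 + \<eta>)\<close>, which cancels when they are compared. The comparisons with
  \<open>E\<close> rest on a margin \<open>\<delta>\<close> with
  \<open>b >= \<beta> + \<delta>\<close>, supplied by compactness. The exponent 3 of the logarithm
  leaves room: the argument gives the square, and \<open>L^2 <= max (L^3) 1\<close> sends the case
  \<open>L < 1\<close> to the second entry of the maximum.\<close>

lemma sigma_pos: "0 < \<rho> \<Longrightarrow> 0 < sigma \<rho>"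
  by (simp add: sigma_def)

lemma sigma_le_1: "0 < \<rho> \<Longrightarrow> sigma \<rho> \<le> 1"
  using exp_ge_add_one_self[of "2 * \<rho>"] by (simp add: sigma_def divide_simps del: exp_ge_add_one_self)

text \<open>Together with \<open>sigma_le\<close> this puts
  \<open>sigma \<rho> - 1 + \<rho>\<close>, the factor with which a linear residual enters in
  \<open>fitted_affine_rhs\<close>, between 0 and the square of \<open>\<rho>\<close>. Clearing the
  denominator with \<open>t = 2 * \<rho>\<close> turns the claim into \<open>q t >= 0\<close>, and
  \<open>q' >= 0\<close> reduces to \<open>1 - t <= exp (- t)\<close>.\<close>

lemma sigma_ge:
  assumes "0 < \<rho>"
  shows "1 - \<rho> \<le> sigma \<rho>"
proof -
  define q :: "real \<Rightarrow> real" where "q t = t - (exp t - 1) * (1 - t / 2)" for t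
  have "q 0 \<le> q (2 * \<rho>)"
  proof (rule DERIV_nonneg_imp_nondecreasing[where f = q])
    show "\<exists>y. (q has_real_derivative y) (at t) \<and> 0 \<le> y" if "0 \<le> t" "t \<le> 2 * \<rho>" for t
    proof (intro exI conjI)
      show "(q has_real_derivative (1 - exp t * (1 - t)) / 2) (at t)"
        unfolding q_def by (auto intro!: derivative_eq_intros simp: field_simps)
      have "exp t * (1 - t) \<le> exp t * exp (- t)"
        using exp_ge_add_one_self[of "- t"] by (intro mult_left_mono) auto
      then show "0 \<le> (1 - exp t * (1 - t)) / 2"
        by (simp add: exp_minus)
    qed
  qed (use assms in auto)
  then show ?thesis
    using assms by (simp add: sigma_def q_def field_simps)
qed

lemma sigma_le:
  assumes "0 < \<rho>"
  shows "sigma \<rho> \<le> 1 - \<rho> + \<rho>\<^sup>2"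
proof -
  have p: "0 < 1 - \<rho> + \<rho>\<^sup>2"
    using zero_le_square[of "\<rho> - 1/2"] by (simp add: power2_eq_square algebra_simps)
  have "1 + 2 * \<rho> + (2 * \<rho>)\<^sup>2 / 2 \<le> exp (2 * \<rho>)"
    by (rule exp_lower_Taylor_quadratic) (use assms in simp)
  then have "(2 * \<rho> + 2 * \<rho>\<^sup>2) * (1 - \<rho> + \<rho>\<^sup>2) \<le> (exp (2 * \<rho>) - 1) * (1 - \<rho> + \<rho>\<^sup>2)"
    using p by (intro mult_right_mono) (auto simp: power_mult_distrib)
  \<comment> \<open>The quadratic upper bound is matched to
    \<open>(1 + r) * (1 - r + r^2) = 1 + r^3\<close>, so only a positive surplus remains.\<close>
  moreover have "(2 * \<rho> + 2 * \<rho>\<^sup>2) * (1 - \<rho> + \<rho>\<^sup>2) = 2 * \<rho> + 2 * \<rho> ^ 4"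
    by algebra
  ultimately have "2 * \<rho> \<le> (exp (2 * \<rho>) - 1) * (1 - \<rho> + \<rho>\<^sup>2)"
    using assms by (smt (verit) zero_le_power)
  then show ?thesis
    using assms by (simp add: sigma_def divide_simps mult.commute)
qed

text \<open>The difference part of \<^const>\<open>ASI_op\<close>, with coefficient value \<open>B\<close>, left step \<open>h\<close> and right step \<open>H\<close>.\<close>

definition fitted :: "real \<Rightarrow> real \<Rightarrow> real \<Rightarrow> real \<Rightarrow> real \<Rightarrow> real \<Rightarrow> real \<Rightarrow> real" where
  "fitted \<epsilon> B h H um u0 up =
     - \<epsilon> * sigma (B * H / (2 * \<epsilon>)) * (((up - u0) / H - (u0 - um) / h) / ((h + H) / 2)) - B * ((up - u0) / H)"

lemma ASI_op_fitted:
  "ASI_op eps b c x U i =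
     fitted eps (b (x i)) (x i - x (i - 1)) (x (i + 1) - x i) (U (i - 1)) (U i) (U (i + 1)) + c (x i) * U i"
  by (simp add: ASI_op_def fitted_def Let_def)

lemma fitted_add:
  "fitted \<epsilon> B h H (um + wm) (u0 + w0) (up + wp) = fitted \<epsilon> B h H um u0 up + fitted \<epsilon> B h H wm w0 wp"
  unfolding fitted_def by (simp add: algebra_simps add_divide_distrib diff_divide_distrib)

lemma fitted_scale:
  "fitted \<epsilon> B h H (k * um) (k * u0) (k * up) = k * fitted \<epsilon> B h H um u0 up"
proof -
  have "k * up - k * u0 = k * (up - u0)" "k * u0 - k * um = k * (u0 - um)"
    by (simp_all add: algebra_simps)
  then have "((k * up - k * u0) / H - (k * u0 - k * um) / h) / ((h + H) / 2)
      = k * (((up - u0) / H - (u0 - um) / h) / ((h + H) / 2))"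
      "(k * up - k * u0) / H = k * ((up - u0) / H)"
    by (simp_all add: algebra_simps diff_divide_distrib)
  then show ?thesis unfolding fitted_def by (simp only: algebra_simps)
qed

lemma fitted_diff:
  "fitted \<epsilon> B h H (um - wm) (u0 - w0) (up - wp) = fitted \<epsilon> B h H um u0 up - fitted \<epsilon> B h H wm w0 wp"
  using fitted_add[of \<epsilon> B h H um "- 1 * wm" u0 "- 1 * w0" up "- 1 * wp"]
    fitted_scale[of \<epsilon> B h H "- 1" wm w0 wp]
  by simp

lemma fitted_affine:
  assumes "0 < h" "0 < H"
  shows "fitted \<epsilon> B h H (p * (x - h) + q) (p * x + q) (p * (x + H) + q) = - B * p"
  using assms by (simp add: fitted_def algebra_simps)

text \<open>On equal steps this is the Il'in-Allen-Southwell scheme. Writing out the fitting factor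
  leaves a forward difference weighted by \<open>exp (B * h / \<epsilon>)\<close> minus a backward
  difference, which exposes the kernel: constants and
  \<open>exp (- B * t / \<epsilon>)\<close>.\<close>

lemma fitted_uniform:
  assumes "0 < \<epsilon>" "0 < B" "0 < h"
  shows "fitted \<epsilon> B h h um u0 up =
    - (B / h) * (exp (B * h / \<epsilon>) * (up - u0) - (u0 - um)) / (exp (B * h / \<epsilon>) - 1)"
proof -
  have "0 < B * h / \<epsilon>" using assms by simp
  then have "1 < exp (B * h / \<epsilon>)" by simp
  then show ?thesis
    using assms by (simp add: fitted_def sigma_def divide_simps) (simp add: algebra_simps)
qed

text \<open>The rate \<open>y = B * h / \<epsilon>\<close> gives zero, and a smaller positive rate
  gives a positive value for positive \<open>q\<close>. The first case is the exactness used in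
  \<open>fitted_nonneg\<close>, the second is the action on \<open>E\<close>.\<close>

lemma fitted_exp:
  assumes "0 < \<epsilon>" "0 < B" "0 < h"
  shows "fitted \<epsilon> B h h (q * exp y) q (q * exp (- y)) =
    B / h * q * (1 - exp (- y)) * (1 - (exp y - 1) / (exp (B * h / \<epsilon>) - 1))"
proof -
  have "0 < B * h / \<epsilon>" using assms by simp
  then have z: "1 < exp (B * h / \<epsilon>)" by simp
  show ?thesis
    unfolding fitted_uniform[OF assms] using assms z
    by (simp add: divide_simps exp_minus) (simp add: algebra_simps)
qed

text \<open>The function \<open>\<phi> = w' exp (B t / \<epsilon>)\<close> is decreasing. Hence adding to \<open>w\<close> the multiple of
  \<open>exp (- B t / \<epsilon>)\<close> that makes its derivative vanish at \<open>x\<close> gives a function with maximum at \<open>x\<close>,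
  and the fitted operator annihilates this exponential.\<close>

lemma fitted_nonneg:
  assumes pos: "0 < \<epsilon>" "0 < B" "0 < h"
    and cont: "continuous_on {x - h..x + h} w"
    and dw: "\<And>t. x - h < t \<Longrightarrow> t < x + h \<Longrightarrow> (w has_real_derivative dw t) (at t)"
    and ddw: "\<And>t. x - h < t \<Longrightarrow> t < x + h \<Longrightarrow> (dw has_real_derivative ddw t) (at t)"
    and rhs: "\<And>t. x - h < t \<Longrightarrow> t < x + h \<Longrightarrow> 0 \<le> - \<epsilon> * ddw t - B * dw t"
  shows "0 \<le> fitted \<epsilon> B h h (w (x - h)) (w x) (w (x + h))"
proof -
  define \<phi> where "\<phi> t = dw t * exp (B * t / \<epsilon>)" for t
  have mono: "\<phi> t \<le> \<phi> s" if "x - h < s" "s \<le> t" "t < x + h" for s t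
  proof (rule DERIV_nonpos_imp_nonincreasing[OF that(2)])
    fix r assume r: "s \<le> r" "r \<le> t"
    have "(\<phi> has_real_derivative (ddw r + B / \<epsilon> * dw r) * exp (B * r / \<epsilon>)) (at r)"
      unfolding \<phi>_def using pos r that
      by (auto intro!: derivative_eq_intros ddw simp: field_simps)
    moreover have "ddw r + B / \<epsilon> * dw r \<le> 0"
      using rhs[of r] pos r that by (simp add: field_simps)
    ultimately show "\<exists>y. (\<phi> has_real_derivative y) (at r) \<and> y \<le> 0"
      by (metis exp_ge_zero mult_nonpos_nonneg)
  qed
  define g where "g t = \<phi> x * (\<epsilon> / B) * exp (- (B * t / \<epsilon>))" for t
  define k where "k t = w t + g t" for t
  have dk: "(k has_real_derivative exp (- (B * t / \<epsilon>)) * (\<phi> t - \<phi> x)) (at t)"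
    if "x - h < t" "t < x + h" for t
    unfolding k_def g_def using pos that
    by (auto intro!: derivative_eq_intros dw simp: \<phi>_def[of t] field_simps simp flip: exp_add)
  have ck: "continuous_on {x - h..x + h} k"
    unfolding k_def g_def using pos by (intro continuous_intros cont) auto
  have l: "k (x - h) \<le> k x"
  proof (rule DERIV_nonneg_imp_increasing_open[where f = k])
    show "\<exists>y. (k has_real_derivative y) (at t) \<and> 0 \<le> y" if "x - h < t" "t < x" for t
      using that pos mono[of t x] by (intro exI[of _ "exp (- (B * t / \<epsilon>)) * (\<phi> t - \<phi> x)"] conjI dk) auto
  qed (use pos in \<open>auto intro: continuous_on_subset[OF ck]\<close>)
  have r: "k (x + h) \<le> k x"
  proof (rule DERIV_nonpos_imp_decreasing_open[where f = k])
    show "\<exists>y. (k has_real_derivative y) (at t) \<and> y \<le> 0" if "x < t" "t < x + h" for t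
      using that pos mono[of x t]
      by (intro exI[of _ "exp (- (B * t / \<epsilon>)) * (\<phi> t - \<phi> x)"] conjI dk) (auto intro: mult_nonneg_nonpos)
  qed (use pos in \<open>auto intro: continuous_on_subset[OF ck]\<close>)
  have "0 < B * h / \<epsilon>" using pos by simp
  then have e: "1 < exp (B * h / \<epsilon>)" by simp
  have "exp (B * h / \<epsilon>) * (k (x + h) - k x) - (k x - k (x - h)) \<le> 0"
    using l r e by (smt (verit) mult_nonneg_nonpos)
  then have "0 \<le> fitted \<epsilon> B h h (k (x - h)) (k x) (k (x + h))"
    unfolding fitted_uniform[OF pos] using e pos
    by (auto intro!: divide_nonpos_nonneg mult_nonneg_nonpos)
  moreover have "fitted \<epsilon> B h h (g (x - h)) (g x) (g (x + h)) = 0"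
  proof -
    have "g (x - h) = g x * exp (B * h / \<epsilon>)" "g (x + h) = g x * exp (- (B * h / \<epsilon>))"
      unfolding g_def using pos by (simp_all add: field_simps flip: exp_add)
    then show ?thesis using fitted_exp[OF pos, of "g x" "B * h / \<epsilon>"] e by simp
  qed
  ultimately show ?thesis
    unfolding k_def by (simp add: fitted_add)
qed

lemma fitted_compare:
  assumes pos: "0 < \<epsilon>" "0 < B" "0 < h"
    and cont: "continuous_on {x - h..x + h} v" "continuous_on {x - h..x + h} w"
    and v: "\<And>t. x - h < t \<Longrightarrow> t < x + h \<Longrightarrow> (v has_real_derivative dv t) (at t)"
      "\<And>t. x - h < t \<Longrightarrow> t < x + h \<Longrightarrow> (dv has_real_derivative ddv t) (at t)"
    and w: "\<And>t. x - h < t \<Longrightarrow> t < x + h \<Longrightarrow> (w has_real_derivative dw t) (at t)"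
      "\<And>t. x - h < t \<Longrightarrow> t < x + h \<Longrightarrow> (dw has_real_derivative ddw t) (at t)"
    and le: "\<And>t. x - h < t \<Longrightarrow> t < x + h \<Longrightarrow> \<bar>- \<epsilon> * ddv t - B * dv t\<bar> \<le> - \<epsilon> * ddw t - B * dw t"
  shows "\<bar>fitted \<epsilon> B h h (v (x - h)) (v x) (v (x + h))\<bar> \<le> fitted \<epsilon> B h h (w (x - h)) (w x) (w (x + h))"
proof -
  have "0 \<le> fitted \<epsilon> B h h (w (x - h) - v (x - h)) (w x - v x) (w (x + h) - v (x + h))"
  proof (rule fitted_nonneg[OF pos, where dw = "\<lambda>t. dw t - dv t" and ddw = "\<lambda>t. ddw t - ddv t"])
    show "0 \<le> - \<epsilon> * (ddw t - ddv t) - B * (dw t - dv t)" if "x - h < t" "t < x + h" for t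
      using le[OF that] by (auto simp: algebra_simps abs_le_iff)
  qed (intro continuous_intros derivative_intros cont v w; assumption)+
  moreover have "0 \<le> fitted \<epsilon> B h h (w (x - h) + v (x - h)) (w x + v x) (w (x + h) + v (x + h))"
  proof (rule fitted_nonneg[OF pos, where dw = "\<lambda>t. dw t + dv t" and ddw = "\<lambda>t. ddw t + ddv t"])
    show "0 \<le> - \<epsilon> * (ddw t + ddv t) - B * (dw t + dv t)" if "x - h < t" "t < x + h" for t
      using le[OF that] by (auto simp: algebra_simps abs_le_iff)
  qed (intro continuous_intros derivative_intros cont v w; assumption)+
  ultimately show ?thesis
    by (simp add: fitted_add fitted_diff)
qed

lemma fitted_affine_rhs:
  assumes pos: "0 < \<epsilon>" "0 < B" "0 < h"
    and cont: "continuous_on {x - h..x + h} v"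
    and v: "\<And>t. x - h < t \<Longrightarrow> t < x + h \<Longrightarrow> (v has_real_derivative dv t) (at t)"
      "\<And>t. x - h < t \<Longrightarrow> t < x + h \<Longrightarrow> (dv has_real_derivative ddv t) (at t)"
    and le: "\<And>t. x - h < t \<Longrightarrow> t < x + h \<Longrightarrow> \<bar>- \<epsilon> * ddv t - B * dv t - k0 - k1 * (t - x)\<bar> \<le> m"
  shows "\<bar>fitted \<epsilon> B h h (v (x - h)) (v x) (v (x + h)) - k0
      - k1 * (\<epsilon> / B * (sigma (B * h / (2 * \<epsilon>)) - 1 + B * h / (2 * \<epsilon>)))\<bar> \<le> m"
proof -
  \<comment> \<open>The quadratic \<open>z\<close> solves
    \<open>- \<epsilon> z'' - B z' = k0 + k1 (t - x)\<close> exactly, and its fitted value is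
    explicit. What is left, \<open>v - z\<close>, has residual at most \<open>m\<close> and is
    compared with the line of slope \<open>- m / B\<close>, whose residual is
    \<open>m\<close>.\<close>
  define z where "z t = - (k0 / B) * (t - x) + k1 * (\<epsilon> / B\<^sup>2 * (t - x) - (t - x)\<^sup>2 / (2 * B))" for t
  define z1 where "z1 t = - (k0 / B) + k1 * (\<epsilon> / B\<^sup>2 - (t - x) / B)" for t
  have dz: "(z has_real_derivative z1 t) (at t)" "(z1 has_real_derivative - k1 / B) (at t)" for t
    unfolding z_def z1_def using pos by (auto intro!: derivative_eq_intros simp: field_simps)
  have rz: "- \<epsilon> * (ddv t - - k1 / B) - B * (dv t - z1 t) = - \<epsilon> * ddv t - B * dv t - k0 - k1 * (t - x)" for t
    using pos by (simp add: z1_def field_simps power2_eq_square)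
  have "\<bar>fitted \<epsilon> B h h (v (x - h) - z (x - h)) (v x - z x) (v (x + h) - z (x + h))\<bar>
     \<le> fitted \<epsilon> B h h (- (m / B) * (x - h) + 0) (- (m / B) * x + 0) (- (m / B) * (x + h) + 0)"
  proof (rule fitted_compare[OF pos, where v = "\<lambda>t. v t - z t" and w = "\<lambda>t. - (m / B) * t + 0"
       and dw = "\<lambda>t. - (m / B)" and ddw = "\<lambda>t. 0"
       and dv = "\<lambda>t. dv t - z1 t" and ddv = "\<lambda>t. ddv t - - k1 / B"])
    show "\<bar>- \<epsilon> * (ddv t - - k1 / B) - B * (dv t - z1 t)\<bar> \<le> - \<epsilon> * 0 - B * - (m / B)"
      if "x - h < t" "t < x + h" for t
      unfolding rz using le[OF that] pos by simp
    show "continuous_on {x - h..x + h} (\<lambda>t. v t - z t)"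
      by (intro continuous_intros cont DERIV_continuous_on[where D = z1] has_field_derivative_at_within[OF dz(1)])
    show "((\<lambda>t. v t - z t) has_real_derivative dv t - z1 t) (at t)" if "x - h < t" "t < x + h" for t
      using that by (intro derivative_intros v dz)
    show "((\<lambda>t. dv t - z1 t) has_real_derivative ddv t - - k1 / B) (at t)" if "x - h < t" "t < x + h" for t
      using that by (intro derivative_intros v dz)
  qed (use pos in \<open>auto intro!: continuous_intros derivative_eq_intros\<close>)
  moreover have "fitted \<epsilon> B h h (z (x - h)) (z x) (z (x + h))
      = k0 + k1 * (\<epsilon> / B * (sigma (B * h / (2 * \<epsilon>)) - 1 + B * h / (2 * \<epsilon>)))"
    unfolding fitted_def z_def using pos
    by (simp add: divide_simps power2_eq_square) (simp add: algebra_simps)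
  ultimately show ?thesis
    using fitted_affine[OF pos(3,3), of \<epsilon> B "- (m / B)" x 0] pos
    by (simp add: fitted_diff algebra_simps)
qed

section \<open>The layer function\<close>

text \<open>Strictness of \<open>pos\<close> spares the usual perturbation. At a negative interior
  minimum it forces a negative second derivative, so \<open>dk\<close> is negative just to the right
  and \<open>k\<close> falls below its minimum.\<close>

lemma minimum_principle:
  fixes k :: "real \<Rightarrow> real"
  assumes eps: "0 < \<epsilon>" and c: "\<And>x. 0 < x \<Longrightarrow> x < 1 \<Longrightarrow> 0 \<le> c x"
    and cont: "continuous_on {0..1} k" and bd: "0 \<le> k 0" "0 \<le> k 1"
    and dk: "\<And>x. 0 < x \<Longrightarrow> x < 1 \<Longrightarrow> (k has_real_derivative dk x) (at x)"
    and ddk: "\<And>x. 0 < x \<Longrightarrow> x < 1 \<Longrightarrow> (dk has_real_derivative ddk x) (at x)"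
    and pos: "\<And>x. 0 < x \<Longrightarrow> x < 1 \<Longrightarrow> 0 < - \<epsilon> * ddk x - b x * dk x + c x * k x"
    and x: "x \<in> {0..1}"
  shows "0 \<le> k x"
proof -
  obtain m where m: "m \<in> {0..1}" and min: "\<And>y. y \<in> {0..1} \<Longrightarrow> k m \<le> k y"
    using continuous_attains_inf[of "{0..1::real}" k] cont by auto
  have "0 \<le> k m"
  proof (rule ccontr)
    assume neg: "\<not> 0 \<le> k m"
    then have m01: "0 < m" "m < 1"
      using m bd by (auto simp: less_le)
    have "dk m = 0"
    proof (rule DERIV_local_min[OF dk[OF m01]])
      show "0 < min m (1 - m)" using m01 by simp
      show "\<forall>y. \<bar>m - y\<bar> < min m (1 - m) \<longrightarrow> k m \<le> k y"
        by (auto intro!: min)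
    qed
    moreover have "c m * k m \<le> 0"
      using c[OF m01] neg by (simp add: mult_nonneg_nonpos)
    ultimately have "ddk m < 0"
      using pos[OF m01] eps mult_nonneg_nonneg[of \<epsilon> "ddk m"] by fastforce
    then obtain d where d: "d > 0" "\<And>h. 0 < h \<Longrightarrow> h < d \<Longrightarrow> dk (m + h) < dk m"
      using DERIV_neg_dec_right[OF ddk[OF m01]] by blast
    define r where "r = min d (1 - m) / 2"
    have r: "0 < r" "r < d" "m + r < 1"
      using d(1) m01 by (auto simp: r_def min_def field_simps)
    have "k (m + r) < k m"
    proof (rule DERIV_neg_imp_decreasing_open[where f = k])
      show "\<exists>y. (k has_real_derivative y) (at t) \<and> y < 0" if "m < t" "t < m + r" for t
        using that r m01 d(2)[of "t - m"] \<open>dk m = 0\<close>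
        by (intro exI[of _ "dk t"] conjI dk) auto
    qed (use r m01 in \<open>auto intro: continuous_on_subset[OF cont]\<close>)
    then show False using min[of "m + r"] r m01 by auto
  qed
  then show ?thesis using min[OF x] by linarith
qed

text \<open>The data fixed before \<open>\<epsilon>\<close> and the mesh, so that every constant
  defined here is uniform in both. \<open>M\<close> will bound the layer function at 0.\<close>

locale convection =
  fixes b b1 b2 c c1 c2 :: "real \<Rightarrow> real" and \<beta> \<delta> K M :: real
  assumes params: "0 < \<beta>" "0 < \<delta>" "1 \<le> K" "0 < M"
    and b_ge: "x \<in> {0..1} \<Longrightarrow> \<beta> + \<delta> \<le> b x" and b_le: "x \<in> {0..1} \<Longrightarrow> b x \<le> K"
    and c_ge: "x \<in> {0..1} \<Longrightarrow> 0 \<le> c x" and c_le: "x \<in> {0..1} \<Longrightarrow> c x \<le> K"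
    and cont_b: "continuous_on {0..1} b"
    and db: "0 < x \<Longrightarrow> x < 1 \<Longrightarrow> (b has_real_derivative b1 x) (at x)"
      "0 < x \<Longrightarrow> x < 1 \<Longrightarrow> (b1 has_real_derivative b2 x) (at x)"
    and dc: "0 < x \<Longrightarrow> x < 1 \<Longrightarrow> (c has_real_derivative c1 x) (at x)"
      "0 < x \<Longrightarrow> x < 1 \<Longrightarrow> (c1 has_real_derivative c2 x) (at x)"
    and bounds: "0 < x \<Longrightarrow> x < 1 \<Longrightarrow> \<bar>b1 x\<bar> \<le> K" "0 < x \<Longrightarrow> x < 1 \<Longrightarrow> \<bar>b2 x\<bar> \<le> K"
      "0 < x \<Longrightarrow> x < 1 \<Longrightarrow> \<bar>c1 x\<bar> \<le> K" "0 < x \<Longrightarrow> x < 1 \<Longrightarrow> \<bar>c2 x\<bar> \<le> K"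
begin

lemma b_pos: "x \<in> {0..1} \<Longrightarrow> 0 < b x"
  using b_ge[of x] params by linarith

lemma abs_b: "x \<in> {0..1} \<Longrightarrow> \<bar>b x\<bar> \<le> K"
  using b_le[of x] b_pos[of x] by simp

lemma abs_c: "x \<in> {0..1} \<Longrightarrow> \<bar>c x\<bar> \<le> K"
  using c_ge[of x] c_le[of x] by simp

text \<open>\<open>C1\<close>, \<open>C2\<close>, \<open>C3\<close> bound the first three
  derivatives of the layer function in units of \<open>E / \<epsilon>^k\<close>. \<open>C1\<close>
  comes from an integrating factor, \<open>C2\<close> and \<open>C3\<close> from solving the
  equation and its derivative for the highest term; the sum \<open>C\<close> serves all
  orders.\<close>

definition "C1 = 2 * M * exp K + K * M / \<delta> * (1 + exp K)"
definition "C2 = K * M + K * C1"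
definition "C3 = K * M + 2 * K * C1 + K * C2"
definition "C = M + C1 + C2 + C3"
text \<open>The two summands are the truncation constants for small and for large steps. The factor
  2 pays for replacing \<open>min (\<eta>^2) 1\<close> by
  \<open>\<eta>^2 / (1 + \<eta>)\<close>.\<close>

definition "C_fine = 2 * (K * C * (4 * exp \<beta> + K) + (2 * K * C * K / (\<beta> * \<delta>) + K * C))"
definition "C_coarse = 3 * K * C * exp \<beta>"
text \<open>\<open>C_fine\<close> divided by the strength
  \<open>\<delta> * \<beta> / (1 + \<beta>)\<close> of the barrier in
  \<open>barrier_fine\<close>.\<close>

definition "C_barrier = C_fine * (1 + \<beta>) / (\<delta> * \<beta>)"
definition "C_source Q w = C_coarse / (1 - Q) * (1 + w\<^sup>2) + 2 * C_barrier * \<beta> * w\<^sup>2 + 1"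
definition "C_error Q w = C_barrier * w\<^sup>2 + C_source Q w / \<beta>"

lemma constants_nonneg: "0 \<le> C1" "0 \<le> C2" "0 \<le> C3" "0 < C"
  and constants_le: "M \<le> C" "C1 \<le> C" "C2 \<le> C" "C3 \<le> C"
proof -
  show 1: "0 \<le> C1" unfolding C1_def using params by simp
  then show 2: "0 \<le> C2" unfolding C2_def using params by simp
  show 3: "0 \<le> C3" unfolding C3_def using params 1 2 by simp
  show "0 < C" "M \<le> C" "C1 \<le> C" "C2 \<le> C" "C3 \<le> C"
    unfolding C_def using params 1 2 3 by simp_all
qed

end

locale layer = convection +
  fixes \<epsilon> :: real and v v1 v2 :: "real \<Rightarrow> real"
  assumes eps: "0 < \<epsilon>" "\<epsilon> < 1"
    and cont_v: "continuous_on {0..1} v"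
    and v_0: "\<bar>v 0\<bar> \<le> M" and v_1: "v 1 = 0"
    and dv: "0 < x \<Longrightarrow> x < 1 \<Longrightarrow> (v has_real_derivative v1 x) (at x)"
      "0 < x \<Longrightarrow> x < 1 \<Longrightarrow> (v1 has_real_derivative v2 x) (at x)"
    and ode: "0 < x \<Longrightarrow> x < 1 \<Longrightarrow> - \<epsilon> * v2 x - b x * v1 x + c x * v x = 0"
begin

section \<open>Exponential bounds for the layer function and its derivatives\<close>

definition E :: "real \<Rightarrow> real" where "E x = exp (- (\<beta> * x / \<epsilon>))"

lemma E_pos: "0 < E x" by (simp add: E_def)

lemma dE: "(E has_real_derivative - (\<beta> / \<epsilon>) * E x) (at x)"
  unfolding E_def using eps by (auto intro!: derivative_eq_intros simp: field_simps)

lemma dEE: "((\<lambda>x. - (\<beta> / \<epsilon>) * E x) has_real_derivative (\<beta> / \<epsilon>)\<^sup>2 * E x) (at x)"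
  using eps by (auto intro!: derivative_eq_intros dE simp: power2_eq_square)

lemma cont_E: "continuous_on A E"
  unfolding E_def using eps by (intro continuous_intros) auto

lemma E_antimono: "x \<le> y \<Longrightarrow> E y \<le> E x"
  unfolding E_def using params eps by (simp add: divide_right_mono)

lemma E_shift: "E (x - h) = E x * exp (\<beta> * h / \<epsilon>)" "E (x + h) = E x * exp (- (\<beta> * h / \<epsilon>))"
  unfolding E_def using eps by (simp_all add: field_simps flip: exp_add)

text \<open>\<open>M * E\<close> is a strict supersolution: the operator maps it to
  \<open>M * E * (\<beta> / \<epsilon> * (b - \<beta>) + c)\<close>, which is positive because of
  the margin \<open>\<delta>\<close>.\<close>

lemma abs_v:
  assumes "x \<in> {0..1}"
  shows "\<bar>v x\<bar> \<le> M * E x"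
proof -
  have *: "0 \<le> M * E x + s * v x" if s: "s = 1 \<or> s = - 1" for s
  proof (rule minimum_principle[of \<epsilon> c "\<lambda>x. M * E x + s * v x"
       "\<lambda>x. M * (- (\<beta> / \<epsilon>) * E x) + s * v1 x" "\<lambda>x. M * ((\<beta> / \<epsilon>)\<^sup>2 * E x) + s * v2 x" b])
    show "0 < - \<epsilon> * (M * ((\<beta> / \<epsilon>)\<^sup>2 * E x) + s * v2 x) - b x * (M * (- (\<beta> / \<epsilon>) * E x) + s * v1 x)
        + c x * (M * E x + s * v x)" if x: "0 < x" "x < 1" for x
    proof -
      have "- \<epsilon> * (M * ((\<beta> / \<epsilon>)\<^sup>2 * E x) + s * v2 x) - b x * (M * (- (\<beta> / \<epsilon>) * E x) + s * v1 x)
        + c x * (M * E x + s * v x) = s * (- \<epsilon> * v2 x - b x * v1 x + c x * v x)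
        + M * E x * (\<beta> / \<epsilon> * (b x - \<beta>) + c x)"
        using eps by (simp add: field_simps power2_eq_square)
      also have "\<dots> = M * E x * (\<beta> / \<epsilon> * (b x - \<beta>) + c x)" using ode[OF x] by simp
      also have "\<dots> > 0"
        using params eps E_pos[of x] b_ge[of x] c_ge[of x] x
        by (intro mult_pos_pos add_pos_nonneg) auto
      finally show ?thesis .
    qed
    show "0 \<le> M * E 0 + s * v 0" using v_0 s by (auto simp: E_def)
    show "0 \<le> M * E 1 + s * v 1" using v_1 params E_pos[of 1] by simp
    show "((\<lambda>x. M * E x + s * v x) has_real_derivative M * (- (\<beta> / \<epsilon>) * E x) + s * v1 x) (at x)"
      if "0 < x" "x < 1" for x
      using that by (intro DERIV_add DERIV_cmult dE dv)
    show "((\<lambda>x. M * (- (\<beta> / \<epsilon>) * E x) + s * v1 x) has_real_derivative M * ((\<beta> / \<epsilon>)\<^sup>2 * E x) + s * v2 x) (at x)"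
      if "0 < x" "x < 1" for x
      using that by (intro DERIV_add DERIV_cmult dEE dv)
  qed (use eps assms c_ge in \<open>auto intro!: continuous_intros cont_E cont_v\<close>)
  from *[of 1] *[of "- 1"] show ?thesis by auto
qed

text \<open>The integrating factor is \<open>exp (B / \<epsilon>)\<close> with
  \<open>B' = b\<close>. A starting value for \<open>v1\<close> comes from the mean value theorem on
  \<open>[0, \<epsilon>]\<close>: it gives a point \<open>x0 < \<epsilon>\<close> with
  \<open>v1 x0 = O(1 / \<epsilon>)\<close>, and there the integrating factor is still at most
  \<open>exp K\<close>.\<close>

lemma abs_v1:
  assumes x: "0 < x" "x < 1"
  shows "\<bar>v1 x\<bar> \<le> C1 / \<epsilon> * E x"
proof -
  obtain l x0 where x0: "0 < x0" "x0 < \<epsilon>" "(v has_real_derivative l) (at x0)" "v \<epsilon> - v 0 = (\<epsilon> - 0) * l"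
  proof -
    have "continuous_on {0..\<epsilon>} v"
      using eps by (intro continuous_on_subset[OF cont_v]) auto
    moreover have "v differentiable (at x)" if "0 < x" "x < \<epsilon>" for x
      using dv(1)[of x] that eps by (auto simp: real_differentiable_def)
    ultimately show thesis using MVT[of 0 \<epsilon> v] eps that by blast
  qed
  have "l = v1 x0" using DERIV_unique[OF x0(3) dv(1)] x0 eps by simp
  then have "\<epsilon> * \<bar>v1 x0\<bar> = \<bar>v \<epsilon> - v 0\<bar>"
    using x0(4) eps by (simp add: abs_mult)
  also have "\<dots> \<le> 2 * M"
  proof -
    have "E \<epsilon> \<le> 1" using eps params by (simp add: E_def)
    then have "M * E \<epsilon> \<le> M" using params by (simp add: mult_left_le)
    then show ?thesis using abs_v[of \<epsilon>] v_0 eps by auto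
  qed
  finally have v1x0: "\<bar>v1 x0\<bar> \<le> 2 * M / \<epsilon>" using eps by (simp add: field_simps)

  define B where "B x = integral {0..x} b" for x
  have dBw: "(B has_real_derivative b t) (at t within {0..1})" if "t \<in> {0..1}" for t
    unfolding B_def by (rule integral_has_real_derivative[OF cont_b that])
  have dB: "(B has_real_derivative b t) (at t)" if "0 < t" "t < 1" for t
    using dBw[of t] that by (simp add: at_within_interior[of t "{0..1}"])
  have cB: "continuous_on {0..1} B"
    using dBw by (rule DERIV_continuous_on)
  have B0: "B 0 = 0" by (simp add: B_def)
  have B_ge: "\<beta> * t \<le> B t" and B_le: "B t \<le> K * t" if "t \<in> {0..1}" for t
  proof -
    have "B 0 - \<beta> * 0 \<le> B t - \<beta> * t"
    proof (rule DERIV_nonneg_imp_increasing_open[where f = "\<lambda>t. B t - \<beta> * t"])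
      show "\<exists>y. ((\<lambda>t. B t - \<beta> * t) has_real_derivative y) (at s) \<and> 0 \<le> y" if s: "0 < s" "s < t" for s
        using s \<open>t \<in> _\<close> b_ge[of s] params
        by (intro exI[of _ "b s - \<beta>"] conjI) (auto intro!: derivative_eq_intros dB)
      show "continuous_on {0..t} (\<lambda>t. B t - \<beta> * t)"
        using that by (intro continuous_intros continuous_on_subset[OF cB]) auto
    qed (use that in auto)
    then show "\<beta> * t \<le> B t" using B0 by simp
    have "B t - K * t \<le> B 0 - K * 0"
    proof (rule DERIV_nonpos_imp_decreasing_open[where f = "\<lambda>t. B t - K * t"])
      show "\<exists>y. ((\<lambda>t. B t - K * t) has_real_derivative y) (at s) \<and> y \<le> 0" if s: "0 < s" "s < t" for s
        using s \<open>t \<in> _\<close> b_le[of s]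
        by (intro exI[of _ "b s - K"] conjI) (auto intro!: derivative_eq_intros dB)
      show "continuous_on {0..t} (\<lambda>t. B t - K * t)"
        using that by (intro continuous_intros continuous_on_subset[OF cB]) auto
    qed (use that in auto)
    then show "B t \<le> K * t" using B0 by simp
  qed

  define y where "y t = v1 t * exp (B t / \<epsilon>)" for t
  define k where "k = K * M / \<delta>"
  \<comment> \<open>\<open>F\<close> is \<open>E\<close> times the integrating factor. Since
    \<open>b - \<beta> >= \<delta>\<close>, the derivative of \<open>k * F\<close> dominates that of
    \<open>y\<close>, so the factor \<open>1 / \<epsilon>\<close> in the source term is integrated
    away; this is where \<open>k\<close> acquires its division by \<open>\<delta>\<close>.\<close>
  define F where "F t = exp ((B t - \<beta> * t) / \<epsilon>)" for t
  have dy: "(y has_real_derivative c t * v t / \<epsilon> * exp (B t / \<epsilon>)) (at t)" if "0 < t" "t < 1" for t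
    unfolding y_def using that eps ode[OF that]
    by (auto intro!: derivative_eq_intros dB dv simp: field_simps)
  have dF: "(F has_real_derivative (b t - \<beta>) / \<epsilon> * F t) (at t)" if "0 < t" "t < 1" for t
    unfolding F_def using that eps by (auto intro!: derivative_eq_intros dB simp: field_simps)
  have le: "\<bar>c t * v t / \<epsilon> * exp (B t / \<epsilon>)\<bar> \<le> k * ((b t - \<beta>) / \<epsilon> * F t)" if t: "0 < t" "t < 1" for t
  proof -
    have "\<bar>c t * v t\<bar> \<le> K * (M * E t)"
      unfolding abs_mult using t abs_v[of t] abs_c[of t] by (intro mult_mono) auto
    then have "\<bar>c t * v t / \<epsilon> * exp (B t / \<epsilon>)\<bar> \<le> K * (M * E t) / \<epsilon> * exp (B t / \<epsilon>)"
      using eps by (simp add: abs_mult divide_right_mono)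
    also have "\<dots> = k * (\<delta> / \<epsilon> * F t)"
      using params by (simp add: F_def E_def k_def diff_divide_distrib exp_diff exp_minus field_simps)
    also have "\<dots> \<le> k * ((b t - \<beta>) / \<epsilon> * F t)"
      using t params eps b_ge[of t]
      by (intro mult_left_mono mult_right_mono divide_right_mono) (auto simp: k_def F_def)
    finally show ?thesis .
  qed
  have mono: "\<bar>y t - y s\<bar> \<le> k * (F t - F s)" if "0 < s" "s \<le> t" "t < 1" for s t
  proof -
    have d: "\<exists>z. ((\<lambda>t. k * F t + \<sigma> * y t) has_real_derivative z) (at r) \<and> 0 \<le> z"
      if "s \<le> r" "r \<le> t" "\<sigma> = 1 \<or> \<sigma> = - 1" for r \<sigma>
    proof (intro exI conjI)
      have r: "0 < r" "r < 1" using that \<open>0 < s\<close> \<open>t < 1\<close> by auto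
      show "((\<lambda>t. k * F t + \<sigma> * y t) has_real_derivative
          k * ((b r - \<beta>) / \<epsilon> * F r) + \<sigma> * (c r * v r / \<epsilon> * exp (B r / \<epsilon>))) (at r)"
        by (intro DERIV_add DERIV_cmult dF dy r)
      show "0 \<le> k * ((b r - \<beta>) / \<epsilon> * F r) + \<sigma> * (c r * v r / \<epsilon> * exp (B r / \<epsilon>))"
        using le[OF r] that(3) by (elim disjE) (simp_all only: abs_le_iff, simp_all)
    qed
    have "k * F s + 1 * y s \<le> k * F t + 1 * y t"
      using d by (intro DERIV_nonneg_imp_nondecreasing[where f = "\<lambda>t. k * F t + 1 * y t", OF that(2)]) blast
    moreover have "k * F s + - 1 * y s \<le> k * F t + - 1 * y t"
      using d by (intro DERIV_nonneg_imp_nondecreasing[where f = "\<lambda>t. k * F t + - 1 * y t", OF that(2)]) blast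
    ultimately show ?thesis by (auto simp: abs_le_iff algebra_simps)
  qed
  have Fpos: "0 < F t" for t by (simp add: F_def)
  have k0: "0 \<le> k" using params by (simp add: k_def)
  have eB: "exp (B x0 / \<epsilon>) \<le> exp K"
  proof -
    have "B x0 \<le> K * x0" using B_le[of x0] x0 eps by auto
    also have "\<dots> \<le> K * \<epsilon>" using params x0 by (intro mult_left_mono) auto
    finally show ?thesis using eps by (simp add: field_simps)
  qed
  have F0: "F x0 \<le> exp K"
  proof -
    have "(B x0 - \<beta> * x0) / \<epsilon> \<le> B x0 / \<epsilon>"
      using params x0 eps by (intro divide_right_mono) auto
    then have "F x0 \<le> exp (B x0 / \<epsilon>)" unfolding F_def by simp
    then show ?thesis using eB by (rule order.trans)
  qed
  \<comment> \<open>Nothing is known about the order of \<open>x\<close> and \<open>x0\<close>, so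
    both end values of \<open>F\<close> are kept.\<close>
  have "\<bar>y x - y x0\<bar> \<le> k * (F x + F x0)"
  proof (cases "x \<le> x0")
    case True
    then have "\<bar>y x - y x0\<bar> \<le> k * (F x0 - F x)" using mono[of x x0] x x0 eps by auto
    also have "\<dots> \<le> k * (F x + F x0)" using k0 Fpos[of x] by (intro mult_left_mono) auto
    finally show ?thesis .
  next
    case False
    then have "\<bar>y x - y x0\<bar> \<le> k * (F x - F x0)" using mono[of x0 x] x x0 eps by auto
    also have "\<dots> \<le> k * (F x + F x0)" using k0 Fpos[of x0] by (intro mult_left_mono) auto
    finally show ?thesis .
  qed
  moreover have "\<bar>y x0\<bar> \<le> 2 * M / \<epsilon> * exp K"
    unfolding y_def abs_mult using v1x0 eB eps params by (intro mult_mono) auto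
  moreover have "k * F x0 \<le> k * exp K" using F0 k0 by (intro mult_left_mono)
  ultimately have "\<bar>y x\<bar> \<le> 2 * M / \<epsilon> * exp K + k * exp K + k * F x"
    by (simp add: algebra_simps)
  then have "\<bar>y x\<bar> * exp (- (B x / \<epsilon>)) \<le> (2 * M / \<epsilon> * exp K + k * exp K + k * F x) * exp (- (B x / \<epsilon>))"
    by (intro mult_right_mono) auto
  moreover have "\<bar>y x\<bar> * exp (- (B x / \<epsilon>)) = \<bar>v1 x\<bar>"
    by (simp add: y_def abs_mult mult.assoc flip: exp_add)
  moreover have "F x * exp (- (B x / \<epsilon>)) = E x"
    unfolding F_def E_def using eps by (simp add: field_simps flip: exp_add)
  moreover have "exp (- (B x / \<epsilon>)) \<le> E x"
    unfolding E_def using B_ge[of x] x eps by (simp add: divide_right_mono)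
  moreover have "0 \<le> 2 * M / \<epsilon> * exp K + k * exp K" using params eps k0 by simp
  ultimately have "\<bar>v1 x\<bar> \<le> (2 * M / \<epsilon> * exp K + k * exp K) * E x + k * E x"
  proof -
    assume a: "\<bar>y x\<bar> * exp (- (B x / \<epsilon>)) \<le> (2 * M / \<epsilon> * exp K + k * exp K + k * F x) * exp (- (B x / \<epsilon>))"
      "\<bar>y x\<bar> * exp (- (B x / \<epsilon>)) = \<bar>v1 x\<bar>" "F x * exp (- (B x / \<epsilon>)) = E x"
    assume "exp (- (B x / \<epsilon>)) \<le> E x" "0 \<le> 2 * M / \<epsilon> * exp K + k * exp K"
    then have "(2 * M / \<epsilon> * exp K + k * exp K) * exp (- (B x / \<epsilon>)) \<le> (2 * M / \<epsilon> * exp K + k * exp K) * E x"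
      by (rule mult_left_mono)
    moreover have "(2 * M / \<epsilon> * exp K + k * exp K + k * F x) * exp (- (B x / \<epsilon>))
        = (2 * M / \<epsilon> * exp K + k * exp K) * exp (- (B x / \<epsilon>)) + k * E x"
      unfolding a(3)[symmetric] by (simp only: distrib_right mult.assoc)
    ultimately show ?thesis using a by linarith
  qed
  also have "\<dots> \<le> (2 * M / \<epsilon> * exp K + k / \<epsilon> * exp K) * E x + k / \<epsilon> * E x"
  proof -
    have "k \<le> k / \<epsilon>" using k0 eps by (simp add: pos_le_divide_eq mult_left_le)
    then show ?thesis using E_pos[of x] by (intro add_mono mult_right_mono order.refl) auto
  qed
  also have "\<dots> = C1 / \<epsilon> * E x"
    unfolding C1_def k_def[symmetric] by (simp add: distrib_left distrib_right add_divide_distrib)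
  finally show ?thesis .
qed

lemma v2_eq: "0 < x \<Longrightarrow> x < 1 \<Longrightarrow> v2 x = (c x * v x - b x * v1 x) / \<epsilon>"
  using ode[of x] eps by (simp add: field_simps)

lemma abs_v2:
  assumes x: "0 < x" "x < 1"
  shows "\<bar>v2 x\<bar> \<le> C2 / \<epsilon>\<^sup>2 * E x"
proof -
  have "\<bar>c x * v x\<bar> \<le> K * (M * E x)"
    unfolding abs_mult using x abs_v[of x] abs_c[of x] by (intro mult_mono) auto
  also have "\<dots> \<le> K * (M * E x) / \<epsilon>"
    using params eps E_pos[of x] by (simp add: field_simps)
  finally have 1: "\<bar>c x * v x\<bar> \<le> K * (M * E x) / \<epsilon>" .
  have 2: "\<bar>b x * v1 x\<bar> \<le> K * (C1 / \<epsilon> * E x)"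
    unfolding abs_mult using x abs_v1[OF x] abs_b[of x] by (intro mult_mono) auto
  have "\<bar>v2 x\<bar> \<le> (K * (M * E x) / \<epsilon> + K * (C1 / \<epsilon> * E x)) / \<epsilon>"
    unfolding v2_eq[OF x] abs_divide using eps 1 2
    by (simp add: divide_right_mono del: times_divide_eq_right)
  also have "\<dots> = C2 / \<epsilon>\<^sup>2 * E x"
    unfolding C2_def using eps by (simp add: field_simps power2_eq_square)
  finally show ?thesis .
qed

definition v3 :: "real \<Rightarrow> real" where
  "v3 x = (c1 x * v x + c x * v1 x - b1 x * v1 x - b x * v2 x) / \<epsilon>"

lemma dv2:
  assumes x: "0 < x" "x < 1"
  shows "(v2 has_real_derivative v3 x) (at x)"
proof -
  have "((\<lambda>x. (c x * v x - b x * v1 x) / \<epsilon>) has_real_derivative v3 x) (at x)"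
    unfolding v3_def using x eps by (auto intro!: derivative_eq_intros db dc dv simp: field_simps)
  moreover have "\<forall>\<^sub>F y in nhds x. v2 y = (c y * v y - b y * v1 y) / \<epsilon>"
    using eventually_nhds_in_open[of "{0<..<1}" x] x by (auto elim!: eventually_mono simp: v2_eq)
  ultimately show ?thesis
    using DERIV_cong_ev[OF refl _ refl, of v2 "\<lambda>y. (c y * v y - b y * v1 y) / \<epsilon>" x "v3 x"] by blast
qed

lemma abs_v3:
  assumes x: "0 < x" "x < 1"
  shows "\<bar>v3 x\<bar> \<le> C3 / \<epsilon> ^ 3 * E x"
proof -
  have e2: "1 \<le> 1 / \<epsilon>\<^sup>2" "1 / \<epsilon> \<le> 1 / \<epsilon>\<^sup>2"
    using eps by (auto simp: field_simps power2_eq_square mult_le_one)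
  have nn: "0 \<le> K * M * E x" "0 \<le> K * C1 * E x"
    using params constants_nonneg E_pos[of x] by auto
  have "\<bar>c1 x * v x\<bar> \<le> K * (M * E x)"
    unfolding abs_mult using x abs_v[of x] bounds[OF x] by (intro mult_mono) auto
  also have "\<dots> \<le> K * M * E x * (1 / \<epsilon>\<^sup>2)"
    using mult_left_mono[OF e2(1) nn(1)] by (simp add: algebra_simps)
  finally have 1: "\<bar>c1 x * v x\<bar> \<le> K * M * E x * (1 / \<epsilon>\<^sup>2)" .
  have "\<bar>c x * v1 x\<bar> \<le> K * (C1 / \<epsilon> * E x)"
    unfolding abs_mult using x abs_v1[OF x] abs_c[of x] by (intro mult_mono) auto
  also have "\<dots> \<le> K * C1 * E x * (1 / \<epsilon>\<^sup>2)"
    using mult_left_mono[OF e2(2) nn(2)] by (simp add: algebra_simps)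
  finally have 2: "\<bar>c x * v1 x\<bar> \<le> K * C1 * E x * (1 / \<epsilon>\<^sup>2)" .
  have "\<bar>b1 x * v1 x\<bar> \<le> K * (C1 / \<epsilon> * E x)"
    unfolding abs_mult using x abs_v1[OF x] bounds[OF x] by (intro mult_mono) auto
  also have "\<dots> \<le> K * C1 * E x * (1 / \<epsilon>\<^sup>2)"
    using mult_left_mono[OF e2(2) nn(2)] by (simp add: algebra_simps)
  finally have 3: "\<bar>b1 x * v1 x\<bar> \<le> K * C1 * E x * (1 / \<epsilon>\<^sup>2)" .
  have 4: "\<bar>b x * v2 x\<bar> \<le> K * (C2 / \<epsilon>\<^sup>2 * E x)"
    unfolding abs_mult using x abs_v2[OF x] abs_b[of x] by (intro mult_mono) auto
  have "\<bar>v3 x\<bar> \<le> (K * M * E x * (1 / \<epsilon>\<^sup>2) + K * C1 * E x * (1 / \<epsilon>\<^sup>2) + K * C1 * E x * (1 / \<epsilon>\<^sup>2)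
      + K * (C2 / \<epsilon>\<^sup>2 * E x)) / \<epsilon>"
    unfolding v3_def abs_divide abs_of_pos[OF eps(1)] using eps 1 2 3 4
    by (intro divide_right_mono) linarith+
  also have "\<dots> = C3 / \<epsilon> ^ 3 * E x"
    unfolding C3_def using eps by (simp add: field_simps power2_eq_square power3_eq_cube)
  finally show ?thesis .
qed

lemma derivative_bounds:
  shows "x \<in> {0..1} \<Longrightarrow> \<bar>v x\<bar> \<le> C * E x"
    and "0 < x \<Longrightarrow> x < 1 \<Longrightarrow> \<bar>v1 x\<bar> \<le> C / \<epsilon> * E x"
    and "0 < x \<Longrightarrow> x < 1 \<Longrightarrow> \<bar>v2 x\<bar> \<le> C / \<epsilon>\<^sup>2 * E x"
    and "0 < x \<Longrightarrow> x < 1 \<Longrightarrow> \<bar>v3 x\<bar> \<le> C / \<epsilon> ^ 3 * E x"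
    using order.trans[OF abs_v mult_right_mono[OF constants_le(1) less_imp_le[OF E_pos]]]
    order.trans[OF abs_v1 mult_right_mono[OF divide_right_mono[OF constants_le(2)] less_imp_le[OF E_pos]]]
    order.trans[OF abs_v2 mult_right_mono[OF divide_right_mono[OF constants_le(3)] less_imp_le[OF E_pos]]]
    order.trans[OF abs_v3 mult_right_mono[OF divide_right_mono[OF constants_le(4)] less_imp_le[OF E_pos]]]
    eps by simp_all

end

section \<open>Truncation error\<close>

lemma taylor_linear_remainder:
  fixes f f1 f2 :: "real \<Rightarrow> real"
  assumes d: "\<And>s. l \<le> s \<Longrightarrow> s \<le> r \<Longrightarrow> (f has_real_derivative f1 s) (at s)"
      "\<And>s. l \<le> s \<Longrightarrow> s \<le> r \<Longrightarrow> (f1 has_real_derivative f2 s) (at s)"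
    and m: "\<And>s. l \<le> s \<Longrightarrow> s \<le> r \<Longrightarrow> \<bar>f2 s\<bar> \<le> m"
    and x: "l \<le> x" "x \<le> r" and t: "l \<le> t" "t \<le> r"
  shows "\<bar>f t - f x - f1 x * (t - x)\<bar> \<le> m / 2 * (t - x)\<^sup>2"
proof (cases "t = x")
  case False
  define D where "D n = (if n = 0 then f else if n = 1 then f1 else f2)" for n :: nat
  have "\<exists>s. (if t < x then t < s \<and> s < x else x < s \<and> s < t) \<and>
    f t = (\<Sum>k<2. D k x / fact k * (t - x) ^ k) + D 2 s / fact 2 * (t - x)\<^sup>2"
    by (rule Taylor[where a = "min x t" and b = "max x t"])
      (use False x t in \<open>auto simp: D_def less_2_cases_iff intro!: d\<close>)
  then obtain s where s: "if t < x then t < s \<and> s < x else x < s \<and> s < t"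
    and eq: "f t = (\<Sum>k<2. D k x / fact k * (t - x) ^ k) + D 2 s / fact 2 * (t - x)\<^sup>2"
    by blast
  have "\<bar>f t - f x - f1 x * (t - x)\<bar> = \<bar>f2 s / 2 * (t - x)\<^sup>2\<bar>"
    using eq by (simp add: D_def numeral_2_eq_2)
  also have "\<bar>f2 s / 2 * (t - x)\<^sup>2\<bar> \<le> m / 2 * (t - x)\<^sup>2"
    using m[of s] s x t by (auto simp: abs_mult split: if_splits intro!: mult_right_mono)
  finally show ?thesis .
qed simp

lemma taylor_quadratic_remainder:
  fixes f f1 f2 f3 :: "real \<Rightarrow> real"
  assumes d: "\<And>s. l \<le> s \<Longrightarrow> s \<le> r \<Longrightarrow> (f has_real_derivative f1 s) (at s)"
      "\<And>s. l \<le> s \<Longrightarrow> s \<le> r \<Longrightarrow> (f1 has_real_derivative f2 s) (at s)"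
      "\<And>s. l \<le> s \<Longrightarrow> s \<le> r \<Longrightarrow> (f2 has_real_derivative f3 s) (at s)"
    and m: "\<And>s. l \<le> s \<Longrightarrow> s \<le> r \<Longrightarrow> \<bar>f3 s\<bar> \<le> m"
    and x: "l \<le> x" "x \<le> r" and t: "l \<le> t" "t \<le> r"
  shows "\<bar>f t - f x - f1 x * (t - x) - f2 x / 2 * (t - x)\<^sup>2\<bar> \<le> m / 6 * \<bar>t - x\<bar> ^ 3"
proof (cases "t = x")
  case False
  define D where "D n = (if n = 0 then f else if n = 1 then f1 else if n = 2 then f2 else f3)" for n :: nat
  have 3: "n < 3 \<longleftrightarrow> n = 0 \<or> n = 1 \<or> n = 2" for n :: nat by auto
  have "\<exists>s. (if t < x then t < s \<and> s < x else x < s \<and> s < t) \<and>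
    f t = (\<Sum>k<3. D k x / fact k * (t - x) ^ k) + D 3 s / fact 3 * (t - x) ^ 3"
    by (rule Taylor[where a = "min x t" and b = "max x t"])
      (use False x t in \<open>auto simp: D_def 3 intro!: d\<close>)
  then obtain s where s: "if t < x then t < s \<and> s < x else x < s \<and> s < t"
    and eq: "f t = (\<Sum>k<3. D k x / fact k * (t - x) ^ k) + D 3 s / fact 3 * (t - x) ^ 3"
    by blast
  have "\<bar>f t - f x - f1 x * (t - x) - f2 x / 2 * (t - x)\<^sup>2\<bar> = \<bar>f3 s / 6 * (t - x) ^ 3\<bar>"
    using eq by (simp add: D_def numeral_3_eq_3 fact_numeral) (simp add: numeral_2_eq_2)
  also have "\<bar>f3 s / 6 * (t - x) ^ 3\<bar> \<le> m / 6 * \<bar>t - x\<bar> ^ 3"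
    using m[of s] s x t by (auto simp: abs_mult power_abs split: if_splits intro!: mult_right_mono)
  finally show ?thesis .
qed simp

lemma abs_mult_le: "\<bar>p\<bar> \<le> P \<Longrightarrow> \<bar>q\<bar> \<le> R \<Longrightarrow> \<bar>p * q\<bar> \<le> P * (R :: real)"
  unfolding abs_mult by (intro mult_mono) auto

lemma lipschitz_of_derivative_bound:
  fixes f f1 :: "real \<Rightarrow> real"
  assumes d: "\<And>s. l < s \<Longrightarrow> s < r \<Longrightarrow> (f has_real_derivative f1 s) (at s)"
    and m: "\<And>s. l < s \<Longrightarrow> s < r \<Longrightarrow> \<bar>f1 s\<bar> \<le> m"
    and x: "l < x" "x < r" and t: "l < t" "t < r"
  shows "\<bar>f t - f x\<bar> \<le> m * \<bar>t - x\<bar>"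
  using field_differentiable_bound[of "{l<..<r}" f f1 m t x] assms
  by (simp add: has_field_derivative_at_within)

context layer
begin

lemma b_lipschitz:
  assumes "0 < x" "x < 1" "0 < t" "t < 1"
  shows "\<bar>b t - b x\<bar> \<le> K * \<bar>t - x\<bar>"
  using lipschitz_of_derivative_bound[of 0 1 b b1 K x t] db bounds assms by blast

lemma residual: "0 < t \<Longrightarrow> t < 1 \<Longrightarrow> - \<epsilon> * v2 t - B * v1 t = (b t - B) * v1 t - c t * v t"
  using ode[of t] by (simp add: algebra_simps)

text \<open>The linear part \<open>g1 x * (t - x)\<close> of the residual of the frozen equation contributes only
  \<open>\<epsilon> / B * (\<sigma>(\<rho>) - 1 + \<rho>) = O(h\<^sup>2 / \<epsilon>)\<close>, which gives second order.\<close>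

lemma truncation_small_step:
  assumes h: "0 < h" "h \<le> \<epsilon>" and x: "0 \<le> x - h" "x + h \<le> 1"
  shows "\<bar>fitted \<epsilon> (b x) h h (v (x - h)) (v x) (v (x + h)) + c x * v x\<bar>
    \<le> K * C * (4 * exp \<beta> + K) * (h / \<epsilon>)\<^sup>2 * E x"
proof -
  define B where "B = b x"
  define g g1 g2 where "g t = (b t - B) * v1 t - c t * v t"
    and "g1 t = b1 t * v1 t + (b t - B) * v2 t - c1 t * v t - c t * v1 t"
    and "g2 t = b2 t * v1 t + 2 * (b1 t * v2 t) + (b t - B) * v3 t - c2 t * v t - 2 * (c1 t * v1 t) - c t * v2 t"
    for t
  have x01: "0 < x" "x < 1" using h x by auto
  have B: "0 < B" "B \<le> K" using b_pos[of x] b_le[of x] x01 by (auto simp: B_def)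
  have dg: "(g has_real_derivative g1 t) (at t)" "(g1 has_real_derivative g2 t) (at t)" if "0 < t" "t < 1" for t
    unfolding g_def g1_def g2_def
    using that by (auto intro!: derivative_eq_intros db dc dv dv2 simp: algebra_simps)
  have e: "1 \<le> 1 / \<epsilon>" "1 \<le> 1 / \<epsilon>\<^sup>2" "1 / \<epsilon> \<le> 1 / \<epsilon>\<^sup>2"
    using eps by (auto simp: field_simps power2_eq_square mult_le_one)
  have CE: "0 \<le> C * E t" for t using constants_nonneg E_pos[of t] by simp
  \<comment> \<open>Counted with multiplicity, \<open>g2\<close> has eight products, each at most
    \<open>K * S\<close>. The critical one contains \<open>v3\<close>; there \<open>b t - B\<close>
    is at most \<open>K * \<epsilon>\<close> because \<open>h <= \<epsilon>\<close>, which restores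
    the order of \<open>v2\<close>. The same restriction on \<open>h\<close> moves \<open>E\<close>
    from the left end to \<open>x\<close> at the cost of \<open>exp \<beta>\<close>.\<close>
  have g2: "\<bar>g2 t\<bar> \<le> 8 * K * C / \<epsilon>\<^sup>2 * exp \<beta> * E x" if t: "x - h < t" "t < x + h" for t
  proof -
    have t01: "0 < t" "t < 1" "t \<in> {0..1}" using t x by auto
    define S where "S = C * E t * (1 / \<epsilon>\<^sup>2)"
    have "\<bar>v t\<bar> \<le> C * E t" using derivative_bounds(1)[of t] t01 by simp
    also have "\<dots> \<le> S" unfolding S_def using mult_left_mono[OF e(2) CE[of t]] by simp
    finally have 0: "\<bar>v t\<bar> \<le> S" .
    have "\<bar>v1 t\<bar> \<le> C * E t * (1 / \<epsilon>)" using derivative_bounds(2)[of t] t01 by (simp add: mult.commute)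
    also have "\<dots> \<le> S" unfolding S_def using mult_left_mono[OF e(3) CE[of t]] by simp
    finally have 1: "\<bar>v1 t\<bar> \<le> S" .
    have 2: "\<bar>v2 t\<bar> \<le> S" unfolding S_def using derivative_bounds(3)[of t] t01 by (simp add: mult.commute)
    have "\<bar>b t - B\<bar> \<le> K * \<bar>t - x\<bar>" unfolding B_def using b_lipschitz x01 t01 by simp
    also have "\<dots> \<le> K * \<epsilon>" using params h t by (intro mult_left_mono) auto
    finally have "\<bar>(b t - B) * v3 t\<bar> \<le> K * \<epsilon> * (C / \<epsilon> ^ 3 * E t)"
      using derivative_bounds(4)[of t] t01 by (intro abs_mult_le) auto
    also have "\<dots> = K * S" unfolding S_def using eps by (simp add: field_simps power2_eq_square power3_eq_cube)
    finally have 3: "\<bar>(b t - B) * v3 t\<bar> \<le> K * S" .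
    have "\<bar>b2 t * v1 t\<bar> \<le> K * S" "\<bar>b1 t * v2 t\<bar> \<le> K * S" "\<bar>c2 t * v t\<bar> \<le> K * S"
      "\<bar>c1 t * v1 t\<bar> \<le> K * S" "\<bar>c t * v2 t\<bar> \<le> K * S"
      by (intro abs_mult_le 0 1 2 bounds abs_c t01)+
    with 3 have "\<bar>g2 t\<bar> \<le> 8 * (K * S)" unfolding g2_def by linarith
    also have "S \<le> C * (exp \<beta> * E x) * (1 / \<epsilon>\<^sup>2)"
    proof -
      have "E t \<le> E (x - h)" using t by (intro E_antimono) auto
      also have "\<dots> \<le> exp \<beta> * E x"
        unfolding E_shift using h eps params E_pos[of x]
        by (simp add: mult.commute[of "E x"] pos_divide_le_eq)
      finally show ?thesis unfolding S_def using constants_nonneg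
        by (intro mult_right_mono mult_left_mono) auto
    qed
    then have "8 * (K * S) \<le> 8 * (K * (C * (exp \<beta> * E x) * (1 / \<epsilon>\<^sup>2)))"
      using params by (intro mult_left_mono) auto
    finally show ?thesis by (simp add: mult_ac)
  qed
  \<comment> \<open>At \<open>x\<close> the term with \<open>v2\<close> vanishes because
    \<open>b x = B\<close>.\<close>
  have g1: "\<bar>g1 x\<bar> \<le> 3 * K * C / \<epsilon> * E x"
  proof -
    have "\<bar>v x\<bar> \<le> C * E x" using derivative_bounds(1)[of x] x01 by simp
    also have "\<dots> \<le> C / \<epsilon> * E x" using mult_left_mono[OF e(1) CE[of x]] by simp
    finally have 0: "\<bar>v x\<bar> \<le> C / \<epsilon> * E x" .
    have "\<bar>b1 x * v1 x\<bar> \<le> K * (C / \<epsilon> * E x)" "\<bar>c1 x * v x\<bar> \<le> K * (C / \<epsilon> * E x)"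
      "\<bar>c x * v1 x\<bar> \<le> K * (C / \<epsilon> * E x)"
      using x01 by (intro abs_mult_le 0 bounds abs_c derivative_bounds; simp)+
    then have "\<bar>g1 x\<bar> \<le> 3 * (K * (C / \<epsilon> * E x))" unfolding g1_def B_def by simp
    then show ?thesis by (simp add: mult_ac)
  qed
  define m where "m = 4 * K * C / \<epsilon>\<^sup>2 * exp \<beta> * E x * h\<^sup>2"
  have "\<bar>fitted \<epsilon> B h h (v (x - h)) (v x) (v (x + h)) - g x
      - g1 x * (\<epsilon> / B * (sigma (B * h / (2 * \<epsilon>)) - 1 + B * h / (2 * \<epsilon>)))\<bar> \<le> m"
  proof (rule fitted_affine_rhs[OF eps(1) B(1) h(1)])
    show "continuous_on {x - h..x + h} v" using x by (intro continuous_on_subset[OF cont_v]) auto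
    fix t assume t: "x - h < t" "t < x + h"
    then have t01: "0 < t" "t < 1" using x by auto
    show "(v has_real_derivative v1 t) (at t)" "(v1 has_real_derivative v2 t) (at t)"
      using dv t01 by auto
    \<comment> \<open>Taylor is applied between \<open>x\<close> and \<open>t\<close> only: the
      stencil may reach 0 or 1, where no derivatives are assumed.\<close>
    have "\<bar>g t - g x - g1 x * (t - x)\<bar> \<le> (8 * K * C / \<epsilon>\<^sup>2 * exp \<beta> * E x) / 2 * (t - x)\<^sup>2"
      by (rule taylor_linear_remainder[of "min x t" "max x t" g g1 g2])
        (use x h t g2 in \<open>auto intro: dg\<close>)
    also have "\<dots> \<le> (8 * K * C / \<epsilon>\<^sup>2 * exp \<beta> * E x) / 2 * h\<^sup>2"
      using t params constants_nonneg eps E_pos[of x] h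
      by (intro mult_left_mono) (auto simp: abs_le_square_iff[symmetric])
    also have "\<dots> = m" by (simp add: m_def)
    finally show "\<bar>- \<epsilon> * v2 t - B * v1 t - g x - g1 x * (t - x)\<bar> \<le> m"
      unfolding residual[OF t01] g_def .
  qed
  moreover have "\<bar>g1 x * (\<epsilon> / B * (sigma (B * h / (2 * \<epsilon>)) - 1 + B * h / (2 * \<epsilon>)))\<bar>
      \<le> (3 * K * C / \<epsilon> * E x) * (K * h\<^sup>2 / (4 * \<epsilon>))"
  proof (rule abs_mult_le[OF g1])
    let ?\<rho> = "B * h / (2 * \<epsilon>)"
    have "0 < ?\<rho>" using B h eps by simp
    then have "0 \<le> sigma ?\<rho> - 1 + ?\<rho>" "sigma ?\<rho> - 1 + ?\<rho> \<le> ?\<rho>\<^sup>2"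
      using sigma_ge[of ?\<rho>] sigma_le[of ?\<rho>] by auto
    then have "\<bar>\<epsilon> / B * (sigma ?\<rho> - 1 + ?\<rho>)\<bar> \<le> \<epsilon> / B * ?\<rho>\<^sup>2"
      using eps B unfolding abs_mult by (intro mult_mono) auto
    also have "\<dots> = B * h\<^sup>2 / (4 * \<epsilon>)"
      using eps B by (simp add: field_simps power2_eq_square)
    also have "\<dots> \<le> K * h\<^sup>2 / (4 * \<epsilon>)"
      using eps B by (intro divide_right_mono mult_right_mono) auto
    finally show "\<bar>\<epsilon> / B * (sigma ?\<rho> - 1 + ?\<rho>)\<bar> \<le> K * h\<^sup>2 / (4 * \<epsilon>)" .
  qed
  moreover have "(3 * K * C / \<epsilon> * E x) * (K * h\<^sup>2 / (4 * \<epsilon>)) \<le> K * C * K * (h / \<epsilon>)\<^sup>2 * E x"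
  proof -
    have "(3 * K * C / \<epsilon> * E x) * (K * h\<^sup>2 / (4 * \<epsilon>)) = 3 / 4 * (K * C * K * (h / \<epsilon>)\<^sup>2 * E x)"
      using eps by (simp add: field_simps power2_eq_square)
    also have "\<dots> \<le> K * C * K * (h / \<epsilon>)\<^sup>2 * E x"
      using params constants_nonneg E_pos[of x] by simp
    finally show ?thesis .
  qed
  moreover have "m = K * C * (4 * exp \<beta>) * (h / \<epsilon>)\<^sup>2 * E x"
    unfolding m_def by (simp add: power_divide)
  moreover have "g x = - (c x * v x)" by (simp add: g_def B_def)
  moreover have "K * C * (4 * exp \<beta> + K) * (h / \<epsilon>)\<^sup>2 * E x
      = K * C * (4 * exp \<beta>) * (h / \<epsilon>)\<^sup>2 * E x + K * C * K * (h / \<epsilon>)\<^sup>2 * E x"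
    by (simp only: distrib_left distrib_right)
  moreover have tri: "\<bar>F + y\<bar> \<le> n" if "\<bar>F - G - q\<bar> \<le> m" "\<bar>q\<bar> \<le> p" "p \<le> p'" "m = m'" "G = - y" "n = m' + p'"
    for F G y q n p p' m m' :: real using that by linarith
  ultimately have "\<bar>fitted \<epsilon> B h h (v (x - h)) (v x) (v (x + h)) + c x * v x\<bar>
      \<le> K * C * (4 * exp \<beta> + K) * (h / \<epsilon>)\<^sup>2 * E x"
    by (intro tri)
  then show ?thesis unfolding B_def .
qed

text \<open>For \<open>h \<ge> \<epsilon>\<close> the Taylor expansion is useless; comparison with a multiple of \<^term>\<open>E\<close>, on which the
  operator is explicit, still gives a bound by \<open>E x\<close> without the factor \<open>1 / \<epsilon>\<close> of \<^term>\<open>v1\<close>.\<close>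

lemma truncation_large_step:
  assumes h: "0 < h" "\<epsilon> \<le> h" and x: "0 \<le> x - h" "x + h \<le> 1"
  shows "\<bar>fitted \<epsilon> (b x) h h (v (x - h)) (v x) (v (x + h)) + c x * v x\<bar>
    \<le> (2 * K * C * K / (\<beta> * \<delta>) + K * C) * E x"
proof -
  define B where "B = b x"
  define k where "k = 2 * K * C * h / (\<beta> * (B - \<beta>))"
  have x01: "0 < x" "x < 1" "x \<in> {0..1}" using h x by auto
  have B: "0 < B" "B \<le> K" "\<delta> \<le> B - \<beta>" using b_pos[of x] b_le[of x] b_ge[of x] x01 by (auto simp: B_def)
  have Bb: "0 < B - \<beta>" using B params by linarith
  have k: "k * (\<beta> * (B - \<beta>)) = 2 * K * C * h"
    unfolding k_def using params Bb by simp
  have k0: "0 \<le> k" unfolding k_def using params constants_nonneg Bb h by simp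
  have "\<bar>fitted \<epsilon> B h h (v (x - h)) (v x) (v (x + h))\<bar>
      \<le> fitted \<epsilon> B h h (k * E (x - h)) (k * E x) (k * E (x + h))"
  proof (rule fitted_compare[where w = "\<lambda>t. k * E t" and v = v, OF eps(1) B(1) h(1)])
    show "continuous_on {x - h..x + h} v" using x by (intro continuous_on_subset[OF cont_v]) auto
    show "continuous_on {x - h..x + h} (\<lambda>t. k * E t)" by (intro continuous_intros cont_E)
    fix t assume t: "x - h < t" "t < x + h"
    then have t01: "0 < t" "t < 1" "t \<in> {0..1}" using x by auto
    show "(v has_real_derivative v1 t) (at t)" "(v1 has_real_derivative v2 t) (at t)"
      using dv t01 by auto
    show "((\<lambda>t. k * E t) has_real_derivative k * (- (\<beta> / \<epsilon>) * E t)) (at t)"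
      "((\<lambda>t. k * (- (\<beta> / \<epsilon>) * E t)) has_real_derivative k * ((\<beta> / \<epsilon>)\<^sup>2 * E t)) (at t)"
      by (intro DERIV_cmult dE dEE)+
    have "\<bar>b t - B\<bar> \<le> K * \<bar>t - x\<bar>" unfolding B_def using b_lipschitz x01 t01 by simp
    also have "\<dots> \<le> K * h" using params h t by (intro mult_left_mono) auto
    finally have "\<bar>(b t - B) * v1 t\<bar> \<le> K * h * (C / \<epsilon> * E t)"
      using derivative_bounds(2)[of t] t01 by (intro abs_mult_le) auto
    moreover have "\<bar>c t * v t\<bar> \<le> K * (C * E t)"
      by (intro abs_mult_le abs_c derivative_bounds t01)
    \<comment> \<open>This is where \<open>\<epsilon> <= h\<close> enters.\<close>
    moreover have "K * (C * E t) \<le> K * h * (C / \<epsilon> * E t)"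
    proof -
      have "K * C * E t * 1 \<le> K * C * E t * (h / \<epsilon>)"
        using params constants_nonneg E_pos[of t] eps h by (intro mult_left_mono) auto
      then show ?thesis by (simp add: mult_ac)
    qed
    ultimately have "\<bar>(b t - B) * v1 t - c t * v t\<bar> \<le> 2 * (K * h * (C / \<epsilon> * E t))" by linarith
    also have "\<dots> = k * (\<beta> * (B - \<beta>)) / \<epsilon> * E t" unfolding k by simp
    also have "\<dots> = - \<epsilon> * (k * ((\<beta> / \<epsilon>)\<^sup>2 * E t)) - B * (k * (- (\<beta> / \<epsilon>) * E t))"
      using eps by (simp add: field_simps power2_eq_square)
    finally show "\<bar>- \<epsilon> * v2 t - B * v1 t\<bar>
        \<le> - \<epsilon> * (k * ((\<beta> / \<epsilon>)\<^sup>2 * E t)) - B * (k * (- (\<beta> / \<epsilon>) * E t))"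
      unfolding residual[OF t01(1,2)] .
  qed
  also have "\<dots> = k * (B / h * E x * ((1 - exp (- (\<beta> * h / \<epsilon>))) *
      (1 - (exp (\<beta> * h / \<epsilon>) - 1) / (exp (B * h / \<epsilon>) - 1))))"
    unfolding fitted_scale E_shift fitted_exp[OF eps(1) B(1) h(1)] by (simp add: mult_ac)
  also have "\<dots> \<le> k * (B / h * E x * 1)"
  proof (intro mult_left_mono)
    have "0 < \<beta> * h / \<epsilon>" "0 < B * h / \<epsilon>" using params h eps B by auto
    then have "1 < exp (\<beta> * h / \<epsilon>)" "1 < exp (B * h / \<epsilon>)" by simp_all
    then show "(1 - exp (- (\<beta> * h / \<epsilon>))) * (1 - (exp (\<beta> * h / \<epsilon>) - 1) / (exp (B * h / \<epsilon>) - 1)) \<le> 1"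
      by (intro order.trans[OF mult_left_le]) auto
  qed (use k0 h B E_pos[of x] in auto)
  also have "\<dots> = 2 * K * C * B / (\<beta> * (B - \<beta>)) * E x"
    unfolding k_def using h by (simp add: field_simps)
  also have "\<dots> \<le> 2 * K * C * K / (\<beta> * \<delta>) * E x"
    using params constants_nonneg E_pos[of x] B
    by (intro mult_right_mono frac_le mult_left_mono mult_nonneg_nonneg mult_pos_pos) auto
  finally have "\<bar>fitted \<epsilon> B h h (v (x - h)) (v x) (v (x + h))\<bar> \<le> 2 * K * C * K / (\<beta> * \<delta>) * E x" .
  moreover have "\<bar>c x * v x\<bar> \<le> K * (C * E x)"
    by (intro abs_mult_le abs_c derivative_bounds x01)
  ultimately show ?thesis unfolding B_def distrib_right mult.assoc[of K C] by linarith
qed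

text \<open>For the coarse mesh first order is enough, so the residual is compared with the constant
  \<open>- c x * v x\<close>, that is with slope \<open>k1 = 0\<close>. Since the step is not
  bounded by \<open>\<epsilon>\<close>, \<open>E\<close> has to be taken at the left
  neighbour.\<close>

lemma truncation_uniform:
  assumes h: "0 < h" and x: "0 \<le> x - h" "x + h \<le> 1"
  shows "\<bar>fitted \<epsilon> (b x) h h (v (x - h)) (v x) (v (x + h)) + c x * v x\<bar> \<le> 3 * K * C * h / \<epsilon> * E (x - h)"
proof -
  define B where "B = b x"
  have x01: "0 < x" "x < 1" "x \<in> {0..1}" using h x by auto
  have B: "0 < B" "B \<le> K" using b_pos[of x] b_le[of x] x01 by (auto simp: B_def)
  have CE: "0 \<le> C / \<epsilon> * E t" for t using constants_nonneg eps E_pos[of t] by simp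
  define S where "S = C / \<epsilon> * E (x - h)"
  have S: "C / \<epsilon> * E t \<le> S" if "x - h < t" for t
    unfolding S_def using that E_antimono[of "x - h" t] constants_nonneg eps by (intro mult_left_mono) auto
  have v1S: "\<bar>v1 t\<bar> \<le> S" if t: "x - h < t" "t < x + h" for t
    using derivative_bounds(2)[of t] S[of t] t x by simp
  have vS: "\<bar>v t\<bar> \<le> S" if t: "x - h < t" "t < x + h" for t
  proof -
    have "\<bar>v t\<bar> \<le> C * E t" using derivative_bounds(1)[of t] t x by simp
    also have "\<dots> \<le> C / \<epsilon> * E t" using eps constants_nonneg E_pos[of t] by (simp add: pos_le_divide_eq mult_left_le)
    also have "\<dots> \<le> S" using S t by simp
    finally show ?thesis .
  qed
  have "\<bar>fitted \<epsilon> B h h (v (x - h)) (v x) (v (x + h)) - - (c x * v x)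
      - 0 * (\<epsilon> / B * (sigma (B * h / (2 * \<epsilon>)) - 1 + B * h / (2 * \<epsilon>)))\<bar> \<le> 3 * (K * S) * h"
  proof (rule fitted_affine_rhs[OF eps(1) B(1) h(1)])
    show "continuous_on {x - h..x + h} v" using x by (intro continuous_on_subset[OF cont_v]) auto
    fix t assume t: "x - h < t" "t < x + h"
    then have t01: "0 < t" "t < 1" "t \<in> {0..1}" using x by auto
    show "(v has_real_derivative v1 t) (at t)" "(v1 has_real_derivative v2 t) (at t)"
      using dv t01 by auto
    have "\<bar>b t - B\<bar> \<le> K * \<bar>t - x\<bar>" unfolding B_def using b_lipschitz x01 t01 by simp
    also have "\<dots> \<le> K * h" using params h t by (intro mult_left_mono) auto
    finally have 1: "\<bar>(b t - B) * v1 t\<bar> \<le> K * h * S"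
      by (intro abs_mult_le v1S t)
    have "\<bar>c t * v t - c x * v x\<bar> \<le> (2 * (K * S)) * \<bar>t - x\<bar>"
    proof (rule lipschitz_of_derivative_bound[where l = "x - h" and r = "x + h" and f = "\<lambda>t. c t * v t"])
      fix s assume s: "x - h < s" "s < x + h"
      then have s01: "0 < s" "s < 1" "s \<in> {0..1}" using x by auto
      show "((\<lambda>t. c t * v t) has_real_derivative c1 s * v s + c s * v1 s) (at s)"
        using s01 by (auto intro!: derivative_eq_intros dc dv)
      have "\<bar>c1 s * v s\<bar> \<le> K * S" "\<bar>c s * v1 s\<bar> \<le> K * S"
        by (intro abs_mult_le bounds abs_c vS v1S s s01)+
      then show "\<bar>c1 s * v s + c s * v1 s\<bar> \<le> 2 * (K * S)" by linarith
    qed (use t h in auto)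
    also have "\<dots> \<le> 2 * (K * S) * h"
      using t params CE[of "x - h", folded S_def] by (intro mult_left_mono mult_nonneg_nonneg) auto
    finally have 2: "\<bar>c t * v t - c x * v x\<bar> \<le> 2 * (K * S) * h" .
    have 3: "K * h * S = K * S * h" by simp
    show "\<bar>- \<epsilon> * v2 t - B * v1 t - - (c x * v x) - 0 * (t - x)\<bar> \<le> 3 * (K * S) * h"
      unfolding residual[OF t01(1,2)] using 1 2 unfolding 3 by linarith
  qed
  moreover have "3 * (K * S) * h = 3 * K * C * h / \<epsilon> * E (x - h)" by (simp add: S_def mult_ac)
  ultimately show ?thesis by (simp add: B_def)
qed

text \<open>Meant for the transition point, where unequal steps rule out the comparison argument of
  \<open>fitted_compare\<close>, so plain Taylor expansion is used. In \<open>Dp - Dm\<close> the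
  first derivatives cancel and the second derivative appears with the mean step, with a first-order
  remainder. The deviation of the fitting factor from 1 is at most \<open>\<rho>\<close>, again of
  first order in \<open>H\<close>.\<close>

lemma truncation_nonuniform:
  assumes h: "0 < h" "h \<le> H" and x: "0 < x - h" "x + H < 1"
  shows "\<bar>fitted \<epsilon> (b x) h H (v (x - h)) (v x) (v (x + H)) + c x * v x\<bar>
    \<le> (K + 1) * C * H / \<epsilon>\<^sup>2 * E (x - h)"
proof -
  define B where "B = b x"
  have H: "0 < H" using h by simp
  have x01: "0 < x" "x < 1" "x \<in> {0..1}" using h x by auto
  have B: "0 < B" "B \<le> K" using b_pos[of x] b_le[of x] x01 by (auto simp: B_def)
  define m2 m3 where "m2 = C / \<epsilon>\<^sup>2 * E (x - h)" and "m3 = C / \<epsilon> ^ 3 * E (x - h)"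
  have m: "0 \<le> m2" "0 \<le> m3" using constants_nonneg eps E_pos[of "x - h"] by (auto simp: m2_def m3_def)
  have x': "x - h \<le> s \<Longrightarrow> s \<le> x + H \<Longrightarrow> 0 < s \<and> s < 1" for s using x by auto
  have v2m: "\<bar>v2 s\<bar> \<le> m2" if "x - h \<le> s" "s \<le> x + H" for s
  proof -
    have "\<bar>v2 s\<bar> \<le> C / \<epsilon>\<^sup>2 * E s" using derivative_bounds(3) x'[OF that] by simp
    also have "\<dots> \<le> m2" unfolding m2_def using constants_nonneg eps E_antimono[OF that(1)]
      by (intro mult_left_mono) auto
    finally show ?thesis .
  qed
  have v3m: "\<bar>v3 s\<bar> \<le> m3" if "x - h \<le> s" "s \<le> x + H" for s
  proof -
    have "\<bar>v3 s\<bar> \<le> C / \<epsilon> ^ 3 * E s" using derivative_bounds(4) x'[OF that] by simp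
    also have "\<dots> \<le> m3" unfolding m3_def using constants_nonneg eps E_antimono[OF that(1)]
      by (intro mult_left_mono) auto
    finally show ?thesis .
  qed
  define Dp Dm D2 where "Dp = (v (x + H) - v x) / H" and "Dm = (v x - v (x - h)) / h"
    and "D2 = (Dp - Dm) / ((h + H) / 2)"
  have taylor: "\<bar>v t - v x - v1 x * (t - x) - v2 x / 2 * (t - x)\<^sup>2\<bar> \<le> m3 / 6 * \<bar>t - x\<bar> ^ 3"
    if "t = x - h \<or> t = x + H" for t
    by (rule taylor_quadratic_remainder[of "x - h" "x + H" v v1 v2 v3])
      (use h that x' v3m in \<open>auto intro: dv dv2\<close>)
  define r1 r2 where "r1 = Dp - v1 x - v2 x / 2 * H" and "r2 = Dm - v1 x + v2 x / 2 * h"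
  have eq: "r1 * H = v (x + H) - v x - v1 x * H - v2 x / 2 * H\<^sup>2"
    unfolding r1_def Dp_def using H by (simp add: field_simps power2_eq_square)
  have "\<bar>r1 * H\<bar> \<le> m3 / 6 * \<bar>H\<bar> ^ 3"
    unfolding eq using taylor[of "x + H"] by simp
  then have "\<bar>r1\<bar> * H \<le> m3 / 6 * H\<^sup>2 * H"
    using H by (simp add: abs_mult power3_eq_cube power2_eq_square)
  then have r1: "\<bar>r1\<bar> \<le> m3 / 6 * H\<^sup>2" using H by simp
  have eq': "r2 * h = - (v (x - h) - v x + v1 x * h - v2 x / 2 * h\<^sup>2)"
    unfolding r2_def Dm_def using h by (simp add: field_simps power2_eq_square)
  have "\<bar>r2 * h\<bar> \<le> m3 / 6 * \<bar>h\<bar> ^ 3"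
    unfolding eq' abs_minus_cancel using taylor[of "x - h"] by simp
  then have "\<bar>r2\<bar> * h \<le> m3 / 6 * h\<^sup>2 * h"
    using h(1) by (simp add: abs_mult power3_eq_cube power2_eq_square)
  then have "\<bar>r2\<bar> \<le> m3 / 6 * h\<^sup>2" using h by simp
  also have "\<dots> \<le> m3 / 6 * H\<^sup>2" using h m by (intro mult_left_mono power_mono) auto
  finally have r2: "\<bar>r2\<bar> \<le> m3 / 6 * H\<^sup>2" .
  have D2: "\<bar>D2 - v2 x\<bar> \<le> m3 * H"
  proof -
    have "(D2 - v2 x) * ((h + H) / 2) = r1 - r2"
      unfolding D2_def r1_def r2_def using h H by (simp add: field_simps)
    then have "\<bar>D2 - v2 x\<bar> * ((h + H) / 2) = \<bar>r1 - r2\<bar>"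
      using h H by (metis abs_mult abs_of_pos add_pos_pos half_gt_zero)
    moreover have "\<bar>D2 - v2 x\<bar> * (H / 2) \<le> \<bar>D2 - v2 x\<bar> * ((h + H) / 2)"
      using h by (intro mult_left_mono) auto
    moreover have "m3 / 6 * H\<^sup>2 + m3 / 6 * H\<^sup>2 \<le> m3 * H * (H / 2)"
      using m H by (simp add: power2_eq_square)
    ultimately have "\<bar>D2 - v2 x\<bar> * (H / 2) \<le> m3 * H * (H / 2)" using r1 r2 by linarith
    then show ?thesis using H by simp
  qed
  have Dp: "\<bar>Dp - v1 x\<bar> \<le> m2 / 2 * H"
  proof -
    have "\<bar>v (x + H) - v x - v1 x * (x + H - x)\<bar> \<le> m2 / 2 * (x + H - x)\<^sup>2"
      by (rule taylor_linear_remainder[of "x - h" "x + H" v v1 v2])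
        (use h x' v2m in \<open>auto intro: dv\<close>)
    moreover have "v (x + H) - v x - v1 x * (x + H - x) = (Dp - v1 x) * H"
      unfolding Dp_def using H by (simp add: field_simps)
    ultimately have "\<bar>Dp - v1 x\<bar> * H \<le> m2 / 2 * H * H"
      using H by (simp add: abs_mult power2_eq_square)
    then show ?thesis using H by simp
  qed
  let ?\<rho> = "B * H / (2 * \<epsilon>)"
  have \<rho>: "0 < ?\<rho>" using B H eps by simp
  have s: "\<bar>sigma ?\<rho>\<bar> \<le> 1" "\<bar>1 - sigma ?\<rho>\<bar> \<le> ?\<rho>"
    using sigma_pos[OF \<rho>] sigma_le_1[OF \<rho>] sigma_ge[OF \<rho>] by auto
  have "c x * v x = \<epsilon> * v2 x + B * v1 x" using ode[of x] x01 by (simp add: B_def)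
  moreover have "fitted \<epsilon> B h H (v (x - h)) (v x) (v (x + H)) = - \<epsilon> * sigma ?\<rho> * D2 - B * Dp"
    by (simp add: fitted_def D2_def Dp_def Dm_def)
  ultimately have "fitted \<epsilon> B h H (v (x - h)) (v x) (v (x + H)) + c x * v x
      = \<epsilon> * ((1 - sigma ?\<rho>) * v2 x) - \<epsilon> * (sigma ?\<rho> * (D2 - v2 x)) - B * (Dp - v1 x)"
    by (simp add: algebra_simps)
  moreover have "\<bar>\<epsilon> * ((1 - sigma ?\<rho>) * v2 x)\<bar> \<le> \<epsilon> * (?\<rho> * m2)"
    using v2m[of x] h by (intro abs_mult_le s) (use eps in auto)
  moreover have "\<bar>\<epsilon> * (sigma ?\<rho> * (D2 - v2 x))\<bar> \<le> \<epsilon> * (1 * (m3 * H))"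
    by (intro abs_mult_le s D2) (use eps in auto)
  moreover have "\<bar>B * (Dp - v1 x)\<bar> \<le> B * (m2 / 2 * H)"
    by (intro abs_mult_le Dp) (use B in auto)
  moreover have "\<epsilon> * (?\<rho> * m2) = B * (m2 / 2 * H)" "\<epsilon> * (1 * (m3 * H)) = m2 * H"
    unfolding m2_def m3_def using eps by (simp_all add: field_simps power2_eq_square power3_eq_cube)
  moreover have "2 * (B * (m2 / 2 * H)) \<le> K * (m2 * H)"
    using B m H by (simp add: mult_right_mono)
  ultimately have "\<bar>fitted \<epsilon> B h H (v (x - h)) (v x) (v (x + H)) + c x * v x\<bar> \<le> K * (m2 * H) + m2 * H"
    by linarith
  also have "\<dots> = (K + 1) * C * H / \<epsilon>\<^sup>2 * E (x - h)"
    unfolding m2_def by (simp add: algebra_simps add_divide_distrib)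
  finally show ?thesis unfolding B_def .
qed

text \<open>The factor \<open>\<eta>^2 / (1 + \<eta>)\<close> joins the two regimes: twice it is at
  least \<open>\<eta>^2\<close> when \<open>\<eta> <= 1\<close> and at least 1 when
  \<open>\<eta> >= 1\<close>.\<close>

lemma truncation_fine:
  assumes h: "0 < h" and x: "0 \<le> x - h" "x + h \<le> 1"
  shows "\<bar>fitted \<epsilon> (b x) h h (v (x - h)) (v x) (v (x + h)) + c x * v x\<bar>
    \<le> C_fine * ((h / \<epsilon>)\<^sup>2 / (1 + h / \<epsilon>)) * E x"
proof -
  define P R \<eta> where "P = K * C * (4 * exp \<beta> + K)" and "R = 2 * K * C * K / (\<beta> * \<delta>) + K * C"
    and "\<eta> = h / \<epsilon>"
  have PR: "0 \<le> P" "0 \<le> R" using params constants_nonneg by (auto simp: P_def R_def)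
  have eq: "C_fine * (\<eta>\<^sup>2 / (1 + \<eta>)) * E x = (P + R) * (2 * (\<eta>\<^sup>2 / (1 + \<eta>))) * E x"
    unfolding C_fine_def P_def[symmetric] R_def[symmetric] by simp
  have \<eta>: "0 < \<eta>" using h eps by (simp add: \<eta>_def)
  have "\<bar>fitted \<epsilon> (b x) h h (v (x - h)) (v x) (v (x + h)) + c x * v x\<bar> \<le> C_fine * (\<eta>\<^sup>2 / (1 + \<eta>)) * E x"
  proof (cases "h \<le> \<epsilon>")
    case True
    then have "\<eta> \<le> 1" using eps by (simp add: \<eta>_def)
    then have "\<eta>\<^sup>2 \<le> 2 * (\<eta>\<^sup>2 / (1 + \<eta>))" using \<eta> by (simp add: field_simps)
    then have "P * \<eta>\<^sup>2 \<le> (P + R) * (2 * (\<eta>\<^sup>2 / (1 + \<eta>)))" using PR \<eta> by (intro mult_mono) auto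
    then have "P * \<eta>\<^sup>2 * E x \<le> (P + R) * (2 * (\<eta>\<^sup>2 / (1 + \<eta>))) * E x"
      using E_pos[of x] by (intro mult_right_mono) auto
    with truncation_small_step[OF h True x, folded P_def \<eta>_def] show ?thesis
      unfolding eq by (rule order.trans)
  next
    case False
    then have "1 \<le> \<eta>" using eps by (simp add: \<eta>_def)
    then have "1 \<le> 2 * (\<eta>\<^sup>2 / (1 + \<eta>))"
    proof -
      have "\<eta> * 1 \<le> \<eta> * \<eta>" using \<open>1 \<le> \<eta>\<close> by (intro mult_left_mono) auto
      then have "1 + \<eta> \<le> 2 * \<eta>\<^sup>2" using \<open>1 \<le> \<eta>\<close> unfolding power2_eq_square by linarith
      then show ?thesis using \<eta> by simp
    qed
    then have "R * 1 \<le> (P + R) * (2 * (\<eta>\<^sup>2 / (1 + \<eta>)))" using PR \<eta> by (intro mult_mono) auto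
    then have "R * E x \<le> (P + R) * (2 * (\<eta>\<^sup>2 / (1 + \<eta>))) * E x"
      using E_pos[of x] by (intro mult_right_mono) auto
    moreover have "\<epsilon> \<le> h" using False by simp
    ultimately show ?thesis
      unfolding eq using truncation_large_step[OF h _ x, folded R_def] by linarith
  qed
  then show ?thesis by (simp add: \<eta>_def)
qed

end

section \<open>Error on the A-mesh\<close>

lemma fitted_nonpos_at_minimum:
  assumes "0 < \<epsilon>" "0 < B" "0 < h" "0 < H" "u0 \<le> um" "u0 \<le> up"
  shows "fitted \<epsilon> B h H um u0 up \<le> 0"
proof -
  have "0 < sigma (B * H / (2 * \<epsilon>))" using assms by (intro sigma_pos) auto
  moreover have "0 \<le> ((up - u0) / H - (u0 - um) / h) / ((h + H) / 2)"
  proof -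
    have "(u0 - um) / h \<le> 0" "0 \<le> (up - u0) / H"
      using assms by (auto intro: divide_nonpos_pos)
    then show ?thesis using assms by (intro divide_nonneg_pos) (linarith, simp)
  qed
  ultimately have "0 \<le> \<epsilon> * sigma (B * H / (2 * \<epsilon>)) * (((up - u0) / H - (u0 - um) / h) / ((h + H) / 2))"
    using assms by (intro mult_nonneg_nonneg) auto
  moreover have "0 \<le> B * ((up - u0) / H)" using assms by simp
  ultimately show ?thesis unfolding fitted_def by simp
qed

lemma ASI_op_add: "ASI_op eps b c x (\<lambda>i. U i + V i) i = ASI_op eps b c x U i + ASI_op eps b c x V i"
  by (simp add: ASI_op_fitted fitted_add algebra_simps)

lemma ASI_op_scale: "ASI_op eps b c x (\<lambda>i. k * U i) i = k * ASI_op eps b c x U i"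
  by (simp add: ASI_op_fitted fitted_scale algebra_simps)

lemma ASI_op_diff: "ASI_op eps b c x (\<lambda>i. U i - V i) i = ASI_op eps b c x U i - ASI_op eps b c x V i"
  by (simp add: ASI_op_fitted fitted_diff algebra_simps)

lemma ASI_op_affine:
  assumes "x (i - 1) < x i" "x i < x (i + 1)"
  shows "ASI_op eps b c x (\<lambda>i. p * x i + q) i = - b (x i) * p + c (x i) * (p * x i + q)"
  using fitted_affine[of "x i - x (i - 1)" "x (i + 1) - x i" eps "b (x i)" p "x i" q] assms
  by (simp add: ASI_op_fitted)

text \<open>Discrete counterpart of \<open>minimum_principle\<close>: at a negative interior minimum
  the difference part and the reaction term are both nonpositive, against the strict
  \<open>pos\<close>.\<close>

lemma ASI_op_nonneg:
  assumes eps: "0 < eps"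
    and mesh: "\<And>i. i < N \<Longrightarrow> x i < x (Suc i)"
    and bc: "\<And>i. 0 < i \<Longrightarrow> i < N \<Longrightarrow> 0 < b (x i)" "\<And>i. 0 < i \<Longrightarrow> i < N \<Longrightarrow> 0 \<le> c (x i)"
    and bd: "0 \<le> W 0" "0 \<le> W N"
    and pos: "\<And>i. 0 < i \<Longrightarrow> i < N \<Longrightarrow> 0 < ASI_op eps b c x W i"
    and i: "i \<le> N"
  shows "0 \<le> W i"
proof -
  obtain m where m: "m \<le> N" and min: "\<And>j. j \<le> N \<Longrightarrow> W m \<le> W j"
    using ex_min_if_finite[of "W ` {..N}"] by (auto simp: not_less)
  have "0 \<le> W m"
  proof (rule ccontr)
    assume neg: "\<not> 0 \<le> W m"
    then have m0: "0 < m" "m < N" using bd m by (auto intro!: gr0I le_neq_implies_less)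
    have "fitted eps (b (x m)) (x m - x (m - 1)) (x (m + 1) - x m) (W (m - 1)) (W m) (W (m + 1)) \<le> 0"
      using eps bc(1)[OF m0] mesh[of m] mesh[of "m - 1"] m0 min[of "m - 1"] min[of "m + 1"]
      by (intro fitted_nonpos_at_minimum) auto
    moreover have "c (x m) * W m \<le> 0" using bc(2)[OF m0] neg by (simp add: mult_nonneg_nonpos)
    ultimately show False using pos[OF m0] by (simp add: ASI_op_fitted)
  qed
  then show ?thesis using min[OF i] by linarith
qed

text \<open>Convexity of \<open>exp\<close> on \<open>[0, z]\<close>. In \<open>barrier_fine\<close>
  the right side becomes \<open>\<beta> / B\<close>, so the gain from the slower rate does not
  depend on the step.\<close>

lemma exp_chord:
  fixes y z :: real
  assumes "0 < y" "y \<le> z"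
  shows "(exp y - 1) / (exp z - 1) \<le> y / z"
proof -
  have "exp ((1 - y / z) *\<^sub>R 0 + (y / z) *\<^sub>R z) \<le> (1 - y / z) * exp 0 + (y / z) * exp z"
    using assms by (intro convex_onD[OF exp_convex]) auto
  then have "exp y - 1 \<le> y / z * (exp z - 1)"
    using assms by (simp add: algebra_simps)
  then show ?thesis using assms by (simp add: pos_divide_le_eq)
qed

text \<open>\<open>4 <= J\<close> limits the growth of \<open>E\<close> one fine step before the
  transition point, and \<open>J + 2 <= N\<close> keeps the right neighbour of that point below
  1.\<close>

locale layer_mesh = layer +
  fixes a Q :: real and N J :: nat
  assumes a: "4 \<le> a" and Q: "0 < Q" "Q < 1" and J: "real J = Q * real N" "4 \<le> J" "J + 2 \<le> N"
    and xi_le: "mesh_xi a \<epsilon> \<beta> (1 / \<epsilon>) \<le> Q"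
begin

definition "\<xi> = mesh_xi a \<epsilon> \<beta> (1 / \<epsilon>)"
definition "L = ln (1 / \<epsilon>)"
definition "h = \<xi> / real J"
definition "H = (1 - \<xi>) / (real N - real J)"
definition "x = mesh_pt a \<epsilon> \<beta> (1 / \<epsilon>) N J"
definition "\<eta> = h / \<epsilon>"
text \<open>The factor in \<open>\<eta> = w * L / N\<close>, free of \<open>\<epsilon>\<close> and
  \<open>N\<close>.\<close>

definition "w = a / (\<beta> * Q)"
text \<open>Freezing \<open>E\<close> beyond the transition point reduces the operator there to
  \<open>c * G\<close>, which leaves the single node \<open>J\<close> to examine.\<close>

definition "G i = E (x (min i J))"

section \<open>Geometry of the mesh and the size of \<open>E\<close> near the transition
  point\<close>

lemma N_pos: "0 < real N" and NJ: "real N - real J = (1 - Q) * real N" "0 < real N - real J"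
  using J Q by (auto simp: algebra_simps)

lemma L_pos: "0 < L" and exp_L: "exp (- L) = \<epsilon>" and \<epsilon>L: "\<epsilon> * L \<le> 1"
proof -
  show "0 < L" using eps by (simp add: L_def)
  show e: "exp (- L) = \<epsilon>" using eps by (simp add: L_def ln_div)
  have "L \<le> exp L" using exp_ge_add_one_self[of L] by linarith
  then have "exp (- L) * L \<le> exp (- L) * exp L" by (intro mult_left_mono) auto
  moreover have "exp (- L) * exp L = 1" by (simp flip: exp_add)
  ultimately show "\<epsilon> * L \<le> 1" unfolding e by linarith
qed

lemma xi_eq: "\<xi> = a * \<epsilon> * L / \<beta>" by (simp add: \<xi>_def mesh_xi_def L_def)

lemma xi: "0 < \<xi>" "\<xi> \<le> Q"
  unfolding xi_eq using a eps L_pos params xi_le by (auto simp: mesh_xi_def L_def)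

lemma h_pos: "0 < h" and H_pos: "0 < H" and Jh: "real J * h = \<xi>"
  and NH: "(real N - real J) * H = 1 - \<xi>"
  using xi Q J NJ by (auto simp: h_def H_def)

lemma h_le: "h \<le> 1 / real N" and H_ge: "1 / real N \<le> H" and H_le: "H \<le> 1 / ((1 - Q) * real N)"
proof -
  have "h \<le> Q / real J" unfolding h_def using xi J by (intro divide_right_mono) auto
  also have "\<dots> = 1 / real N" using J Q N_pos by simp
  finally show "h \<le> 1 / real N" .
  have "1 / real N = (1 - Q) / (real N - real J)" unfolding NJ using Q by simp
  also have "\<dots> \<le> H" unfolding H_def using xi NJ by (intro divide_right_mono) auto
  finally show "1 / real N \<le> H" .
  show "H \<le> 1 / ((1 - Q) * real N)"
    unfolding H_def NJ(1) using xi Q N_pos by (intro divide_right_mono) auto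
qed

lemma h_le_H: "h \<le> H" using h_le H_ge by linarith

lemma \<eta>_pos: "0 < \<eta>"
  using eps h_pos by (simp add: \<eta>_def)

lemma \<eta>_eq: "\<eta> = w * L / real N"
  using params eps J Q by (simp add: \<eta>_def w_def h_def xi_eq)

lemma x_fine: "i \<le> J \<Longrightarrow> x i = real i * h"
  by (simp add: x_def mesh_pt_def h_def \<xi>_def Let_def)

lemma x_coarse: "J \<le> i \<Longrightarrow> x i = \<xi> + (real i - real J) * H"
  using Jh by (cases "i = J") (simp_all add: x_fine, simp add: x_def mesh_pt_def H_def \<xi>_def Let_def)

lemma x_ends: "x 0 = 0" "x N = 1" "x J = \<xi>"
  using x_coarse[of N] x_coarse[of J] NH J by (auto simp: x_fine)

lemma x_step_fine: "i < J \<Longrightarrow> x (Suc i) = x i + h"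
  by (simp add: x_fine algebra_simps)

lemma x_step_coarse: "J \<le> i \<Longrightarrow> x (Suc i) = x i + H"
  by (simp add: x_coarse algebra_simps)

lemma x_step: "x i < x (Suc i)"
  using x_step_fine[of i] x_step_coarse[of i] h_pos H_pos by (cases "i < J") auto

lemma x_mono: "i \<le> j \<Longrightarrow> x i \<le> x j"
  by (rule lift_Suc_mono_le[of x]) (auto simp: less_imp_le x_step)

lemma x_strict_mono: "i < j \<Longrightarrow> x i < x j"
  using x_step by (rule lift_Suc_mono_less)

lemma x_in: "i \<le> N \<Longrightarrow> x i \<in> {0..1}"
  using x_mono[of 0 i] x_mono[of i N] x_ends by auto

lemma x_inside: "0 < i \<Longrightarrow> i < N \<Longrightarrow> 0 < x i \<and> x i < 1"
  using x_strict_mono[of 0 i] x_strict_mono[of i N] x_ends by auto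

lemma E_\<xi>: "E \<xi> \<le> \<epsilon> ^ 4"
proof -
  have "E \<xi> = exp (- (a * L))" unfolding E_def xi_eq using eps params by (simp add: field_simps)
  also have "\<dots> \<le> exp (of_nat 4 * - L)" using a L_pos by simp
  also have "\<dots> = \<epsilon> ^ 4" unfolding exp_of_nat_mult exp_L ..
  finally show ?thesis .
qed

text \<open>One step back costs the fraction \<open>1 / J\<close> of the exponent
  \<open>a * L\<close>; with \<open>J >= 4\<close> at least three quarters remain, that is
  \<open>3 * L\<close>.\<close>

lemma E_before_\<xi>: "E (\<xi> - h) \<le> \<epsilon> ^ 3"
proof -
  have "E (\<xi> - h) = exp (- (a * L * (1 - 1 / real J)))"
    unfolding E_def h_def xi_eq using eps params J by (simp add: field_simps)
  also have "\<dots> \<le> exp (of_nat 3 * - L)"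
  proof -
    have "1 / real J \<le> 1 / 4" using J by (intro divide_left_mono) auto
    then have "4 * (3 / 4) \<le> a * (1 - 1 / real J)" using a by (intro mult_mono) auto
    then have "3 * L \<le> a * (1 - 1 / real J) * L" using L_pos by (intro mult_right_mono) auto
    then show ?thesis by (simp add: mult_ac)
  qed
  also have "\<dots> = \<epsilon> ^ 3" unfolding exp_of_nat_mult exp_L ..
  finally show ?thesis .
qed

text \<open>After division by \<open>\<epsilon>^2\<close> in the truncation error,
  \<open>\<epsilon>^3\<close> alone would leave only \<open>\<epsilon>\<close>. For
  \<open>\<eta> <= 1\<close> the step back costs just \<open>exp \<beta>\<close> against
  \<open>\<epsilon>^4\<close>; otherwise \<open>\<eta>^2 >= 1\<close> is inserted, giving a term of
  the order of the fine-mesh error.\<close>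

lemma E_before_\<xi>_sharp: "E (\<xi> - h) \<le> exp \<beta> * \<epsilon> ^ 4 + \<eta>\<^sup>2 * \<epsilon> ^ 3"
proof (cases "\<eta> \<le> 1")
  case True
  have "E (\<xi> - h) = E \<xi> * exp (\<beta> * \<eta>)" unfolding E_shift \<eta>_def by simp
  also have "\<dots> \<le> \<epsilon> ^ 4 * exp \<beta>"
    using E_\<xi> E_pos[of \<xi>] True params eps by (intro mult_mono) (auto simp: mult_left_le)
  also have "\<dots> \<le> exp \<beta> * \<epsilon> ^ 4 + \<eta>\<^sup>2 * \<epsilon> ^ 3" using eps by simp
  finally show ?thesis .
next
  case False
  then have "1 * \<epsilon> ^ 3 \<le> \<eta>\<^sup>2 * \<epsilon> ^ 3" using eps by (intro mult_right_mono one_le_power) auto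
  moreover have "0 \<le> exp \<beta> * \<epsilon> ^ 4" using eps by simp
  ultimately show ?thesis using E_before_\<xi> by linarith
qed

lemma error_constants_nonneg: "0 \<le> C_fine" "0 \<le> C_coarse" "0 \<le> C_barrier" "0 \<le> w"
proof -
  show 1: "0 \<le> C_fine" using params constants_nonneg by (simp add: C_fine_def)
  show "0 \<le> C_coarse" using params constants_nonneg by (simp add: C_coarse_def)
  show "0 \<le> C_barrier" using params 1 by (simp add: C_barrier_def)
  show "0 \<le> w" using params a Q by (simp add: w_def)
qed

section \<open>Consistency and barriers on the two parts of the mesh\<close>

lemma consistency_fine:
  assumes "0 < i" "i < J"
  shows "\<bar>ASI_op \<epsilon> b c x (\<lambda>i. v (x i)) i\<bar> \<le> C_fine * (\<eta>\<^sup>2 / (1 + \<eta>)) * E (x i)"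
proof -
  have "x (i - 1) = x i - h" "x (i + 1) = x i + h"
    using x_step_fine[of "i - 1"] x_step_fine[of i] assms by auto
  moreover have "x (i - 1) \<in> {0..1}" "x (i + 1) \<in> {0..1}" using assms J by (auto intro!: x_in simp del: atLeastAtMost_iff)
  ultimately show ?thesis
    using truncation_fine[OF h_pos, of "x i"] by (simp add: ASI_op_fitted \<eta>_def)
qed

lemma consistency_coarse:
  assumes "J \<le> i" "i < N"
  shows "\<bar>ASI_op \<epsilon> b c x (\<lambda>i. v (x i)) i\<bar> \<le> C_coarse / (1 - Q) * (\<epsilon>\<^sup>2 / real N + \<epsilon> * \<eta>\<^sup>2)"
proof -
  have nn: "0 \<le> \<epsilon> * \<eta>\<^sup>2" "0 \<le> \<epsilon>\<^sup>2" using eps by auto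
  have KC: "0 \<le> K * C" using params constants_nonneg by simp
  have eb: "1 \<le> exp \<beta>" using params by simp
  have "\<bar>ASI_op \<epsilon> b c x (\<lambda>i. v (x i)) i\<bar> \<le> C_coarse * (\<epsilon>\<^sup>2 + \<epsilon> * \<eta>\<^sup>2) * H"
  proof (cases "i = J")
    case True
    have xx: "x (i - 1) = \<xi> - h" "x (i + 1) = \<xi> + H" "x i = \<xi>"
      using x_step_fine[of "i - 1"] x_step_coarse[of i] x_ends True J by auto
    \<comment> \<open>Strictness matters: \<open>truncation_nonuniform\<close> expands up to both
      neighbours and needs derivatives there.\<close>
    have "0 < x (i - 1)" "x (i + 1) < 1"
      using x_inside[of "i - 1"] x_inside[of "i + 1"] True J by auto
    then have "\<bar>ASI_op \<epsilon> b c x (\<lambda>i. v (x i)) i\<bar> \<le> (K + 1) * C * H / \<epsilon>\<^sup>2 * E (\<xi> - h)"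
      unfolding xx using truncation_nonuniform[OF h_pos h_le_H, of \<xi>] by (simp add: ASI_op_fitted xx del: One_nat_def add_Suc_right)
    also have "\<dots> \<le> (K + 1) * C * H / \<epsilon>\<^sup>2 * (exp \<beta> * \<epsilon> ^ 4 + \<eta>\<^sup>2 * \<epsilon> ^ 3)"
      using params constants_nonneg H_pos by (intro mult_left_mono E_before_\<xi>_sharp) auto
    also have "\<dots> = (K + 1) * C * (exp \<beta> * \<epsilon>\<^sup>2 + 1 * (\<epsilon> * \<eta>\<^sup>2)) * H"
      using eps by (simp add: field_simps power2_eq_square power3_eq_cube power4_eq_xxxx)
    also have "\<dots> \<le> (3 * K) * C * (exp \<beta> * \<epsilon>\<^sup>2 + exp \<beta> * (\<epsilon> * \<eta>\<^sup>2)) * H"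
      using params constants_nonneg H_pos eb nn eps
      by (intro mult_right_mono mult_mono add_mono mult_nonneg_nonneg add_nonneg_nonneg) auto
    also have "\<dots> = C_coarse * (\<epsilon>\<^sup>2 + \<epsilon> * \<eta>\<^sup>2) * H" by (simp add: C_coarse_def algebra_simps)
    finally show ?thesis .
  next
    case False
    then have i: "J < i" using assms by simp
    have xx: "x (i - 1) = x i - H" "x (i + 1) = x i + H"
      using x_step_coarse[of "i - 1"] x_step_coarse[of i] i by auto
    moreover have "x (i - 1) \<in> {0..1}" "x (i + 1) \<in> {0..1}" using assms by (auto intro!: x_in simp del: atLeastAtMost_iff)
    ultimately have "\<bar>ASI_op \<epsilon> b c x (\<lambda>i. v (x i)) i\<bar> \<le> 3 * K * C * H / \<epsilon> * E (x i - H)"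
      using truncation_uniform[OF H_pos, of "x i"] by (simp add: ASI_op_fitted)
    also have "E (x i - H) \<le> \<epsilon> ^ 4"
      using E_antimono[of \<xi> "x i - H"] x_mono[of J "i - 1"] xx i x_ends E_\<xi> by auto
    then have "3 * K * C * H / \<epsilon> * E (x i - H) \<le> 3 * K * C * H / \<epsilon> * \<epsilon> ^ 4"
      using params constants_nonneg H_pos eps by (intro mult_left_mono) auto
    also have "\<dots> = 3 * (K * C) * (1 * \<epsilon> ^ 3) * H"
      using eps by (simp add: field_simps power3_eq_cube power4_eq_xxxx)
    also have "\<dots> \<le> 3 * (K * C) * (exp \<beta> * (\<epsilon>\<^sup>2 + \<epsilon> * \<eta>\<^sup>2)) * H"
    proof (intro mult_right_mono mult_left_mono mult_mono)
      have "\<epsilon> ^ 3 \<le> \<epsilon>\<^sup>2" using eps by (intro power_decreasing) auto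
      then show "\<epsilon> ^ 3 \<le> \<epsilon>\<^sup>2 + \<epsilon> * \<eta>\<^sup>2" using nn by linarith
    qed (use KC H_pos eps eb in auto)
    also have "\<dots> = C_coarse * (\<epsilon>\<^sup>2 + \<epsilon> * \<eta>\<^sup>2) * H" by (simp add: C_coarse_def algebra_simps)
    finally show ?thesis .
  qed
  also have "\<dots> \<le> C_coarse * (\<epsilon>\<^sup>2 + \<epsilon> * \<eta>\<^sup>2) * (1 / ((1 - Q) * real N))"
    using error_constants_nonneg nn eps by (intro mult_left_mono H_le mult_nonneg_nonneg add_nonneg_nonneg) auto
  also have "\<dots> = C_coarse / (1 - Q) * (\<epsilon>\<^sup>2 / real N + \<epsilon> * \<eta>\<^sup>2 * (1 / real N))"
    using Q N_pos by (simp add: field_simps)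
  \<comment> \<open>The factor \<open>1 / N\<close> is given up on the second term only, which
    already has the order of the fine-mesh error.\<close>
  also have "\<dots> \<le> C_coarse / (1 - Q) * (\<epsilon>\<^sup>2 / real N + \<epsilon> * \<eta>\<^sup>2 * 1)"
    using error_constants_nonneg nn N_pos Q J by (intro mult_left_mono add_left_mono) (auto simp: divide_le_eq)
  finally show ?thesis by simp
qed

text \<open>\<open>fitted_exp\<close> with rates \<open>y = \<beta> * \<eta>\<close> and
  \<open>z = B * \<eta>\<close> leaves two factors: \<open>1 - exp (- y) >= y / (1 + y)\<close>, and
  one that \<open>exp_chord\<close> bounds below by \<open>1 - \<beta> / B >= \<delta> / B\<close>.
  The first is the source of \<open>1 / (1 + \<eta>)\<close>.\<close>

lemma barrier_fine:
  assumes "0 < i" "i < J"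
  shows "\<delta> * \<beta> / (1 + \<beta>) / \<epsilon> * E (x i) / (1 + \<eta>) \<le> ASI_op \<epsilon> b c x G i"
proof -
  have xx: "x (i - 1) = x i - h" "x (i + 1) = x i + h"
    using x_step_fine[of "i - 1"] x_step_fine[of i] assms by auto
  have xi: "x i \<in> {0..1}" using assms J by (intro x_in) auto
  define B where "B = b (x i)"
  have B: "0 < B" "\<beta> + \<delta> \<le> B" using b_pos[OF xi] b_ge[OF xi] by (auto simp: B_def)
  define y z where "y = \<beta> * h / \<epsilon>" and "z = B * h / \<epsilon>"
  have y: "0 < y" using params h_pos eps by (simp add: y_def)
  have yz: "y \<le> z" unfolding y_def z_def using B params h_pos eps
    by (intro divide_right_mono mult_right_mono) auto
  have G: "G (i - 1) = E (x i) * exp y" "G i = E (x i)" "G (i + 1) = E (x i) * exp (- y)"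
  proof -
    have "min (i - 1) J = i - 1" "min i J = i" "min (i + 1) J = i + 1" using assms by auto
    then show "G (i - 1) = E (x i) * exp y" "G i = E (x i)" "G (i + 1) = E (x i) * exp (- y)"
      unfolding G_def y_def by (simp_all only: xx E_shift)
  qed
  have "\<delta> * \<beta> / (1 + \<beta>) / \<epsilon> * E (x i) / (1 + \<eta>) = \<delta> * \<beta> / \<epsilon> * E (x i) / ((1 + \<beta>) * (1 + \<eta>))"
    by (simp add: mult_ac)
  also have "\<dots> \<le> \<delta> * \<beta> / \<epsilon> * E (x i) / (1 + y)"
  proof (rule divide_left_mono)
    show "1 + y \<le> (1 + \<beta>) * (1 + \<eta>)"
    proof -
      have "y = \<beta> * \<eta>" by (simp add: y_def \<eta>_def)
      then show ?thesis using params \<eta>_pos by (simp add: algebra_simps)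
    qed
  qed (use params eps E_pos[of "x i"] y \<eta>_pos in auto)
  also have "\<dots> = B / h * E (x i) * (y / (1 + y)) * (\<delta> / B)"
  proof -
    have "\<delta> * \<beta> / \<epsilon> = \<delta> * (y / h)" using h_pos by (simp add: y_def)
    then show ?thesis using B by simp
  qed
  also have "\<dots> \<le> B / h * E (x i) * (1 - exp (- y)) * (1 - (exp y - 1) / (exp z - 1))"
  proof (intro mult_mono mult_left_mono)
    have "exp (- y) * (1 + y) \<le> exp (- y) * exp y" using exp_ge_add_one_self[of y] by (intro mult_left_mono) auto
    then have "exp (- y) * (1 + y) \<le> 1" by (simp flip: exp_add)
    then show "y / (1 + y) \<le> 1 - exp (- y)" using y by (simp add: field_simps)
    have "(exp y - 1) / (exp z - 1) \<le> y / z" using y yz by (rule exp_chord)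
    also have "y / z = \<beta> / B" unfolding y_def z_def using h_pos eps by simp
    also have "\<beta> / B \<le> 1 - \<delta> / B" using B by (simp add: field_simps)
    finally show "\<delta> / B \<le> 1 - (exp y - 1) / (exp z - 1)" by simp
  qed (use B h_pos E_pos[of "x i"] y params in auto)
  also have "\<dots> = fitted \<epsilon> B h h (G (i - 1)) (G i) (G (i + 1))"
    unfolding G z_def by (rule fitted_exp[OF eps(1) B(1) h_pos, symmetric])
  also have "\<dots> \<le> ASI_op \<epsilon> b c x G i"
    using c_ge[OF xi] E_pos[of "x i"] xx by (simp add: ASI_op_fitted B_def G)
  finally show ?thesis .
qed

text \<open>\<^term>\<open>G\<close> is constant beyond \<^term>\<open>\<xi>\<close>, so it fails to be a supersolution only at the transition point.
  The defect there is small enough for the linear barrier of \<open>error_bound\<close>.\<close>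

lemma barrier_coarse:
  assumes "J \<le> i" "i < N"
  shows "- (2 * real N * \<beta> * \<epsilon> ^ 3) \<le> ASI_op \<epsilon> b c x G i"
proof -
  have xi: "x i \<in> {0..1}" using assms by (intro x_in) auto
  have B: "0 < b (x i)" using b_pos[OF xi] .
  have cG: "0 \<le> c (x i) * G i" using c_ge[OF xi] E_pos by (simp add: G_def less_imp_le)
  show ?thesis
  proof (cases "i = J")
    case True
    have xx: "x i - x (i - 1) = h" "x (i + 1) - x i = H"
      using x_step_fine[of "i - 1"] x_step_coarse[of i] x_ends True J by auto
    have G: "G (i - 1) = E (\<xi> - h)" "G i = E \<xi>" "G (i + 1) = E \<xi>"
      using True xx x_ends by (auto simp: G_def min_def algebra_simps)
    define s where "s = sigma (b (x i) * H / (2 * \<epsilon>))"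
    have s: "0 \<le> s" "s \<le> 1" unfolding s_def
      using sigma_pos sigma_le_1 B H_pos eps by (auto simp: less_imp_le)
    have "exp (- (\<beta> * h / \<epsilon>)) \<ge> 1 + - (\<beta> * h / \<epsilon>)" by (rule exp_ge_add_one_self)
    then have "E (\<xi> - h) * (1 + - (\<beta> * h / \<epsilon>)) \<le> E (\<xi> - h) * exp (- (\<beta> * h / \<epsilon>))"
      using E_pos[of "\<xi> - h"] by (intro mult_left_mono) auto
    also have "\<dots> = E \<xi>" using E_shift(2)[of "\<xi> - h" h] by simp
    finally have d: "(E (\<xi> - h) - E \<xi>) / h \<le> \<beta> / \<epsilon> * E (\<xi> - h)"
      using h_pos eps by (simp add: field_simps)
    have "0 \<le> (E (\<xi> - h) - E \<xi>) / h"
      using E_antimono[of "\<xi> - h" \<xi>] h_pos by simp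
    moreover have "(E (\<xi> - h) - E \<xi>) / h \<le> \<beta> / \<epsilon> * \<epsilon> ^ 3"
    proof -
      have "\<beta> / \<epsilon> * E (\<xi> - h) \<le> \<beta> / \<epsilon> * \<epsilon> ^ 3"
        using params eps by (intro mult_left_mono E_before_\<xi>) auto
      then show ?thesis using d by linarith
    qed
    \<comment> \<open>The slope of \<open>G\<close> jumps to zero here. The jump, at most
      \<open>\<beta> * \<epsilon>^2\<close>, is divided by the mean step, which the coarse step
      alone keeps above \<open>1 / (2 * N)\<close>.\<close>
    moreover have "1 / (2 * real N) \<le> (h + H) / 2" using H_ge h_pos by simp
    ultimately have "(E (\<xi> - h) - E \<xi>) / h / ((h + H) / 2) \<le> (\<beta> / \<epsilon> * \<epsilon> ^ 3) / (1 / (2 * real N))"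
      using N_pos params eps by - (rule frac_le, auto)
    moreover have "0 \<le> (E (\<xi> - h) - E \<xi>) / h / ((h + H) / 2)"
      using E_antimono[of "\<xi> - h" \<xi>] h_pos H_pos by simp
    ultimately have "\<epsilon> * s * ((E (\<xi> - h) - E \<xi>) / h / ((h + H) / 2))
        \<le> \<epsilon> * 1 * ((\<beta> / \<epsilon> * \<epsilon> ^ 3) / (1 / (2 * real N)))"
      using s eps by (intro mult_mono) auto
    also have "\<dots> = 2 * real N * \<beta> * \<epsilon> ^ 3" using eps by simp
    finally have "- (2 * real N * \<beta> * \<epsilon> ^ 3) \<le> - (\<epsilon> * s * ((E (\<xi> - h) - E \<xi>) / h / ((h + H) / 2)))"
      by simp
    also have "\<dots> = - \<epsilon> * s * (((E \<xi> - E \<xi>) / H - (E \<xi> - E (\<xi> - h)) / h) / ((h + H) / 2))"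
    proof -
      have "(E \<xi> - E \<xi>) / H - (E \<xi> - E (\<xi> - h)) / h = (E (\<xi> - h) - E \<xi>) / h"
        by (simp add: diff_divide_distrib)
      then show ?thesis by simp
    qed
    also have "\<dots> = fitted \<epsilon> (b (x i)) h H (G (i - 1)) (G i) (G (i + 1))"
      unfolding fitted_def s_def G by simp
    also have "\<dots> \<le> ASI_op \<epsilon> b c x G i"
      using cG xx by (simp add: ASI_op_fitted)
    finally show ?thesis .
  next
    case False
    then have "min (i - 1) J = J" "min i J = J" "min (i + 1) J = J" using assms by auto
    then have "G (i - 1) = G i" "G (i + 1) = G i" by (simp_all only: G_def)
    then have "ASI_op \<epsilon> b c x G i = c (x i) * G i" by (simp add: ASI_op_fitted fitted_def)
    moreover have "0 \<le> 2 * real N * \<beta> * \<epsilon> ^ 3" using params eps by simp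
    ultimately show ?thesis using cG by linarith
  qed
qed

text \<open>In \<open>\<Psi>\<close> the multiple of \<open>G\<close> dominates the fine truncation
  error, while \<open>S / \<beta> * (1 - x)\<close> adds at least \<open>S\<close> at every interior
  node and covers the coarse nodes together with the defect of \<open>G\<close>. Comparison with
  both signs of the error finishes.\<close>

lemma error_bound:
  assumes U: "U 0 = v 0" "U N = v 1" "\<And>i. 0 < i \<Longrightarrow> i < N \<Longrightarrow> ASI_op \<epsilon> b c x U i = 0"
    and i: "i \<le> N"
  shows "\<bar>v (x i) - U i\<bar> \<le> C_error Q w * (\<epsilon> * L\<^sup>2 / (real N)\<^sup>2 + \<epsilon>\<^sup>2 / real N)"
proof -
  define A where "A = C_barrier"
  define R where "R = C_coarse / (1 - Q)"
  \<comment> \<open>In this order: the coarse truncation error, the defect of the scaled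
    \<open>G\<close> at the transition point, and a spare \<open>\<epsilon>^2 / N\<close> that makes
    the inequality in \<open>main\<close> strict.\<close>
  define S where "S = R * (\<epsilon>\<^sup>2 / real N + \<epsilon> * \<eta>\<^sup>2) + 2 * A * \<beta> * w\<^sup>2 * (\<epsilon>\<^sup>2 / real N) + \<epsilon>\<^sup>2 / real N"
  have R0: "0 \<le> R" and A0: "0 \<le> A" using error_constants_nonneg Q by (auto simp: R_def A_def)
  have eN: "0 < \<epsilon>\<^sup>2 / real N" using eps N_pos by simp
  have nn: "0 \<le> R * (\<epsilon>\<^sup>2 / real N + \<epsilon> * \<eta>\<^sup>2)" "0 \<le> 2 * A * \<beta> * w\<^sup>2 * (\<epsilon>\<^sup>2 / real N)"
    using R0 A0 eN eps params by auto
  have S: "R * (\<epsilon>\<^sup>2 / real N + \<epsilon> * \<eta>\<^sup>2) + 2 * A * \<beta> * w\<^sup>2 * (\<epsilon>\<^sup>2 / real N) < S" "0 < S"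
    unfolding S_def using nn eN by linarith+
  define \<Psi> where "\<Psi> i = A * \<epsilon> * \<eta>\<^sup>2 * G i + S / \<beta> * (- 1 * x i + 1)" for i
  have linear: "S \<le> ASI_op \<epsilon> b c x (\<lambda>i. S / \<beta> * (- 1 * x i + 1)) i" if "0 < i" "i < N" for i
  proof -
    have xi: "x i \<in> {0..1}" using that by (intro x_in) auto
    have "ASI_op \<epsilon> b c x (\<lambda>i. S / \<beta> * (- 1 * x i + 1)) i = S / \<beta> * ASI_op \<epsilon> b c x (\<lambda>i. - 1 * x i + 1) i"
      by (rule ASI_op_scale)
    also have "\<dots> = S / \<beta> * (b (x i) + c (x i) * (1 - x i))"
      using x_strict_mono[of "i - 1" i] x_strict_mono[of i "i + 1"] that by (subst ASI_op_affine) auto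
    also have "\<dots> \<ge> S / \<beta> * \<beta>"
      using b_ge[OF xi] c_ge[OF xi] xi params S
      by (intro mult_left_mono add_increasing2) auto
    finally show ?thesis using params by simp
  qed
  have main: "\<bar>ASI_op \<epsilon> b c x (\<lambda>i. v (x i)) i\<bar> < ASI_op \<epsilon> b c x \<Psi> i" if i: "0 < i" "i < N" for i
  proof -
    have \<Psi>: "ASI_op \<epsilon> b c x \<Psi> i = A * \<epsilon> * \<eta>\<^sup>2 * ASI_op \<epsilon> b c x G i + ASI_op \<epsilon> b c x (\<lambda>i. S / \<beta> * (- 1 * x i + 1)) i"
      unfolding \<Psi>_def by (simp only: ASI_op_add ASI_op_scale)
    show ?thesis
    proof (cases "i < J")
      case True
      have "C_fine * (\<eta>\<^sup>2 / (1 + \<eta>)) * E (x i)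
          = A * \<epsilon> * \<eta>\<^sup>2 * (\<delta> * \<beta> / (1 + \<beta>) / \<epsilon> * E (x i) / (1 + \<eta>))"
      proof -
        have "A * (\<delta> * \<beta> / (1 + \<beta>)) = C_fine" unfolding A_def C_barrier_def using params by simp
        then have "C_fine * (\<eta>\<^sup>2 / (1 + \<eta>)) * E (x i)
            = A * (\<delta> * \<beta> / (1 + \<beta>)) * (\<eta>\<^sup>2 / (1 + \<eta>)) * E (x i) * (\<epsilon> / \<epsilon>)"
          using eps by simp
        then show ?thesis by (simp add: mult_ac)
      qed
      also have "\<dots> \<le> A * \<epsilon> * \<eta>\<^sup>2 * ASI_op \<epsilon> b c x G i"
        using A0 eps by (intro mult_left_mono barrier_fine i True) auto
      finally show ?thesis
        using consistency_fine[OF i(1) True] linear[OF i] S unfolding \<Psi> by linarith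
    next
      case False
      \<comment> \<open>The \<open>\<eta>^2\<close> in the weight supplies \<open>1 / N^2\<close>
        against the factor \<open>N\<close> of the defect, and its logarithms are absorbed by
        \<open>\<epsilon> * L <= 1\<close>.\<close>
      have "A * \<epsilon> * \<eta>\<^sup>2 * (2 * real N * \<beta> * \<epsilon> ^ 3) = 2 * A * \<beta> * w\<^sup>2 * (\<epsilon>\<^sup>2 / real N) * (\<epsilon> * L)\<^sup>2"
        unfolding \<eta>_eq using N_pos by (simp add: field_simps power2_eq_square power3_eq_cube)
      also have "\<dots> \<le> 2 * A * \<beta> * w\<^sup>2 * (\<epsilon>\<^sup>2 / real N) * 1"
        using nn(2) \<epsilon>L L_pos eps by (intro mult_left_mono power_le_one) auto
      finally have "A * \<epsilon> * \<eta>\<^sup>2 * (2 * real N * \<beta> * \<epsilon> ^ 3) \<le> 2 * A * \<beta> * w\<^sup>2 * (\<epsilon>\<^sup>2 / real N)" by simp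
      moreover have "A * \<epsilon> * \<eta>\<^sup>2 * - (2 * real N * \<beta> * \<epsilon> ^ 3) \<le> A * \<epsilon> * \<eta>\<^sup>2 * ASI_op \<epsilon> b c x G i"
        using False i A0 eps by (intro mult_left_mono barrier_coarse) auto
      moreover have "\<bar>ASI_op \<epsilon> b c x (\<lambda>i. v (x i)) i\<bar> \<le> R * (\<epsilon>\<^sup>2 / real N + \<epsilon> * \<eta>\<^sup>2)"
        unfolding R_def using False i by (intro consistency_coarse) auto
      ultimately show ?thesis
        using linear[OF i] S unfolding \<Psi> mult_minus_right by linarith
    qed
  qed
  have G0: "0 \<le> G i" "G i \<le> 1" if "i \<le> N" for i
    using E_pos[of "x (min i J)"] E_antimono[of 0 "x (min i J)"] x_mono[of 0 "min i J"] x_ends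
    by (auto simp: G_def E_def)
  have \<Psi>0: "0 \<le> \<Psi> i" if "i \<le> N" for i
  proof -
    have "0 \<le> A * \<epsilon> * \<eta>\<^sup>2 * G i" using G0[OF that] A0 eps by simp
    moreover have "0 \<le> S / \<beta> * (- 1 * x i + 1)"
      using x_in[OF that] S params by (intro mult_nonneg_nonneg) auto
    ultimately show ?thesis unfolding \<Psi>_def by linarith
  qed
  have comparison: "0 \<le> \<Psi> i + s * (v (x i) - U i)" if s: "s = 1 \<or> s = - 1" for s
  proof (rule ASI_op_nonneg[of \<epsilon> N x b c "\<lambda>i. \<Psi> i + s * (v (x i) - U i)"])
    show "0 < ASI_op \<epsilon> b c x (\<lambda>i. \<Psi> i + s * (v (x i) - U i)) i" if "0 < i" "i < N" for i
      using main[OF that] U(3)[OF that] s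
      by (auto simp: ASI_op_add ASI_op_scale ASI_op_diff)
  qed (use eps x_step x_inside b_pos c_ge U x_ends \<Psi>0[of 0] \<Psi>0[of N] i in \<open>auto simp: less_imp_le\<close>)
  have "\<bar>v (x i) - U i\<bar> \<le> \<Psi> i" using comparison[of 1] comparison[of "- 1"] by auto
  also have "\<dots> \<le> A * \<epsilon> * \<eta>\<^sup>2 * 1 + S / \<beta> * 1"
    unfolding \<Psi>_def using G0[OF i] x_in[OF i] A0 S eps params
    by (intro add_mono mult_left_mono) auto
  also have "\<dots> \<le> C_error Q w * (\<epsilon> * L\<^sup>2 / (real N)\<^sup>2 + \<epsilon>\<^sup>2 / real N)"
  proof -
    define X Y where "X = \<epsilon> * L\<^sup>2 / (real N)\<^sup>2" and "Y = \<epsilon>\<^sup>2 / real N"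
    have XY: "0 \<le> X" "0 \<le> Y" using eps by (auto simp: X_def Y_def)
    have \<eta>X: "\<epsilon> * \<eta>\<^sup>2 = w\<^sup>2 * X" unfolding \<eta>_eq X_def by (simp add: power_mult_distrib power_divide)
    have "S \<le> C_source Q w * (X + Y)"
    proof -
      have "S = R * (Y + w\<^sup>2 * X) + 2 * A * \<beta> * w\<^sup>2 * Y + 1 * Y" unfolding S_def \<eta>X Y_def by simp
      also have "\<dots> \<le> R * ((1 + w\<^sup>2) * (X + Y)) + 2 * A * \<beta> * w\<^sup>2 * (X + Y) + 1 * (X + Y)"
        using R0 A0 XY params by (intro add_mono mult_left_mono) (auto simp: algebra_simps)
      also have "\<dots> = C_source Q w * (X + Y)"
        unfolding C_source_def R_def A_def by (simp only: distrib_right mult.assoc)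
      finally show ?thesis .
    qed
    then have "S / \<beta> \<le> C_source Q w / \<beta> * (X + Y)"
      using params by (simp add: divide_right_mono)
    moreover have "A * w\<^sup>2 * X \<le> A * w\<^sup>2 * (X + Y)" using A0 XY by (intro mult_left_mono) auto
    ultimately have "A * w\<^sup>2 * X + S / \<beta> \<le> C_error Q w * (X + Y)"
      unfolding C_error_def A_def by (simp only: distrib_right)
    moreover have "A * \<epsilon> * \<eta>\<^sup>2 * 1 = A * w\<^sup>2 * X" using \<eta>X by (simp add: mult.assoc)
    ultimately show ?thesis unfolding X_def Y_def by simp
  qed
  finally show ?thesis .
qed

end

section \<open>Uniform constants from the data, and the conclusion\<close>

lemma C4_01_bounds:
  assumes "C4_01 g"
  obtains g1 g2 :: "real \<Rightarrow> real" and K :: real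
  where "continuous_on {0..1} g"
    and "\<And>x. x \<in> {0..1} \<Longrightarrow> \<bar>g x\<bar> \<le> K"
    and "\<And>x. 0 < x \<Longrightarrow> x < 1 \<Longrightarrow> (g has_real_derivative g1 x) (at x)"
    and "\<And>x. 0 < x \<Longrightarrow> x < 1 \<Longrightarrow> (g1 has_real_derivative g2 x) (at x)"
    and "\<And>x. 0 < x \<Longrightarrow> x < 1 \<Longrightarrow> \<bar>g1 x\<bar> \<le> K"
    and "\<And>x. 0 < x \<Longrightarrow> x < 1 \<Longrightarrow> \<bar>g2 x\<bar> \<le> K"
proof -
  obtain d :: "nat \<Rightarrow> real \<Rightarrow> real" where d0: "d 0 = g"
    and d: "\<And>k x. k < 4 \<Longrightarrow> x \<in> {0..1} \<Longrightarrow> (d k has_real_derivative d (Suc k) x) (at x within {0..1})"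
    using assms unfolding C4_01_def by blast
  have cont: "continuous_on {0..1} (d k)" if "k < 4" for k
    using d[OF that] by (rule DERIV_continuous_on)
  have "\<exists>K. \<forall>x\<in>{0..1}. \<bar>d k x\<bar> \<le> K" if "k < 4" for k
    using compact_imp_bounded[OF compact_continuous_image[OF cont[OF that] compact_Icc]]
    by (auto simp: bounded_iff)
  then obtain K where K: "\<And>k x. k < 4 \<Longrightarrow> x \<in> {0..1} \<Longrightarrow> \<bar>d k x\<bar> \<le> K k"
    by metis
  have at: "(d k has_real_derivative d (Suc k) x) (at x)" if "k < 4" "0 < x" "x < 1" for k x
    using d[of k x] that by (simp add: at_within_interior[of x "{0..1}"])
  show thesis
  proof (rule that[of "max (K 0) (max (K 1) (K 2))" "d 1" "d 2"])
    show "continuous_on {0..1} g" using cont[of 0] d0 by simp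
    show "\<bar>g x\<bar> \<le> max (K 0) (max (K 1) (K 2))" if "x \<in> {0..1}" for x
      using K[of 0 x] that d0 by simp
    fix x :: real assume x: "0 < x" "x < 1"
    show "(g has_real_derivative d 1 x) (at x)" using at[of 0 x] x d0 by simp
    show "(d 1 has_real_derivative d 2 x) (at x)" using at[of 1 x] x by (simp add: numeral_2_eq_2)
    show "\<bar>d 1 x\<bar> \<le> max (K 0) (max (K 1) (K 2))" using K[of 1 x] x by simp
    show "\<bar>d 2 x\<bar> \<le> max (K 0) (max (K 1) (K 2))" using K[of 2 x] x by simp
  qed
qed

theorem theorem7:
  fixes b c f :: "real \<Rightarrow> real" and \<beta> Q a :: real
  assumes "C4_01 b" and "C4_01 c" and "C4_01 f"
    and "\<beta> > 0" and "\<forall>x\<in>{0..1}. b x > \<beta>" and "\<forall>x\<in>{0..1}. c x \<ge> 0"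
    and "Q \<in> \<rat>" and "0 < Q" and "Q < 1"
    and "a \<ge> 4"
    and "reduced_solution_linear b c f"
  shows "\<exists>N0 :: nat. \<exists>C :: real. \<forall>eps :: real. \<forall>N J :: nat. \<forall>u :: real \<Rightarrow> real. \<forall>U :: nat \<Rightarrow> real.
     0 < eps \<and> eps < 1 \<and> N \<ge> N0 \<and> real J = Q * real N \<and>
     mesh_xi a eps \<beta> (1 / eps) \<le> Q \<and>
     is_bvp_solution eps b c f u \<and>
     U 0 = 0 \<and> U N = 0 \<and>
     (\<forall>i. 1 \<le> i \<and> i \<le> N - 1 \<longrightarrow>
        ASI_op eps b c (mesh_pt a eps \<beta> (1 / eps) N J) U i = f (mesh_pt a eps \<beta> (1 / eps) N J i))
     \<longrightarrow> (\<forall>i\<le>N. \<bar>u (mesh_pt a eps \<beta> (1 / eps) N J i) - U i\<bar>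
            \<le> C * max (eps * \<bar>ln eps\<bar> ^ 3 / real N ^ 2)
                       (eps / real N ^ 2 + eps\<^sup>2 / real N))"
proof -
  obtain b1 b2 Kb where b: "continuous_on {0..1} b" "\<And>x. x \<in> {0..1} \<Longrightarrow> \<bar>b x\<bar> \<le> Kb"
    "\<And>x. 0 < x \<Longrightarrow> x < 1 \<Longrightarrow> (b has_real_derivative b1 x) (at x)"
    "\<And>x. 0 < x \<Longrightarrow> x < 1 \<Longrightarrow> (b1 has_real_derivative b2 x) (at x)"
    "\<And>x. 0 < x \<Longrightarrow> x < 1 \<Longrightarrow> \<bar>b1 x\<bar> \<le> Kb" "\<And>x. 0 < x \<Longrightarrow> x < 1 \<Longrightarrow> \<bar>b2 x\<bar> \<le> Kb"
    by (rule C4_01_bounds[OF assms(1)]) (rule that)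
  obtain c1 c2 Kc where c: "continuous_on {0..1} c" "\<And>x. x \<in> {0..1} \<Longrightarrow> \<bar>c x\<bar> \<le> Kc"
    "\<And>x. 0 < x \<Longrightarrow> x < 1 \<Longrightarrow> (c has_real_derivative c1 x) (at x)"
    "\<And>x. 0 < x \<Longrightarrow> x < 1 \<Longrightarrow> (c1 has_real_derivative c2 x) (at x)"
    "\<And>x. 0 < x \<Longrightarrow> x < 1 \<Longrightarrow> \<bar>c1 x\<bar> \<le> Kc" "\<And>x. 0 < x \<Longrightarrow> x < 1 \<Longrightarrow> \<bar>c2 x\<bar> \<le> Kc"
    by (rule C4_01_bounds[OF assms(2)]) (rule that)
  obtain p q where pq: "p * 1 + q = 0"
    and reduced: "\<And>x. x \<in> {0<..<1} \<Longrightarrow> - b x * p + c x * (p * x + q) = f x"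
    using assms(11) unfolding reduced_solution_linear_def by blast
  \<comment> \<open>A minimum point of \<open>b\<close> yields the margin
    \<open>\<delta>\<close>.\<close>
  obtain m where m: "m \<in> {0..1}" "\<And>y. y \<in> {0..1} \<Longrightarrow> b m \<le> b y"
    using continuous_attains_inf[of "{0..1::real}" b] b(1) by auto
  define \<delta> where "\<delta> = b m - \<beta>"
  define K where "K = max 1 (max Kb Kc)"
  \<comment> \<open>The layer function starts at \<open>u 0 - q = p\<close>, since
    \<open>p + q = 0\<close>; adding 1 makes \<open>M\<close> positive.\<close>
  define M where "M = \<bar>p\<bar> + 1"
  have K: "1 \<le> K" "Kb \<le> K" "Kc \<le> K" by (auto simp: K_def)
  interpret convection b b1 b2 c c1 c2 \<beta> \<delta> K M
  proof
    show "0 < \<delta>" using assms(5) m(1) by (simp add: \<delta>_def)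
    show "\<beta> + \<delta> \<le> b x" if "x \<in> {0..1}" for x using m(2)[OF that] by (simp add: \<delta>_def)
    show "b x \<le> K" if "x \<in> {0..1}" for x using b(2)[OF that] K by linarith
    show "c x \<le> K" if "x \<in> {0..1}" for x using c(2)[OF that] K by linarith
    show "0 \<le> c x" if "x \<in> {0..1}" for x using assms(6) that by blast
    fix x :: real assume x: "0 < x" "x < 1"
    show "\<bar>b1 x\<bar> \<le> K" "\<bar>b2 x\<bar> \<le> K" "\<bar>c1 x\<bar> \<le> K" "\<bar>c2 x\<bar> \<le> K"
      using b(5,6)[OF x] c(5,6)[OF x] K by linarith+
  qed (fact assms(4) K(1) b(1,3,4) c(3,4) | simp add: M_def)+
  define D where "D = C_error Q (a / (\<beta> * Q))"
  \<comment> \<open>\<open>N >= 4 / Q\<close> gives \<open>J >= 4\<close>, and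
    \<open>N >= 2 / (1 - Q)\<close> gives \<open>J + 2 <= N\<close>.\<close>
  define N0 where "N0 = nat \<lceil>max (4 / Q) (2 / (1 - Q))\<rceil>"
  show ?thesis
  proof (intro exI[of _ N0] exI[of _ "2 * D"] allI impI)
    fix eps :: real and N J :: nat and u :: "real \<Rightarrow> real" and U :: "nat \<Rightarrow> real" and i :: nat
    assume *: "0 < eps \<and> eps < 1 \<and> N \<ge> N0 \<and> real J = Q * real N \<and>
     mesh_xi a eps \<beta> (1 / eps) \<le> Q \<and>
     is_bvp_solution eps b c f u \<and>
     U 0 = 0 \<and> U N = 0 \<and>
     (\<forall>i. 1 \<le> i \<and> i \<le> N - 1 \<longrightarrow>
        ASI_op eps b c (mesh_pt a eps \<beta> (1 / eps) N J) U i = f (mesh_pt a eps \<beta> (1 / eps) N J i))"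
      and i: "i \<le> N"
    obtain u1 u2 where u: "continuous_on {0..1} u" "u 0 = 0" "u 1 = 0"
      "\<And>x. x \<in> {0<..<1} \<Longrightarrow> (u has_real_derivative u1 x) (at x)"
      "\<And>x. x \<in> {0<..<1} \<Longrightarrow> (u1 has_real_derivative u2 x) (at x)"
      "\<And>x. x \<in> {0<..<1} \<Longrightarrow> - eps * u2 x - b x * u1 x + c x * u x = f x"
      using * unfolding is_bvp_solution_def by blast
    have "max (4 / Q) (2 / (1 - Q)) \<le> real N" using * by (simp add: N0_def)
    then have N: "4 \<le> Q * real N" "2 \<le> (1 - Q) * real N"
      using assms(8,9) by (auto simp: divide_le_eq mult.commute)
    interpret layer_mesh b b1 b2 c c1 c2 \<beta> \<delta> K M eps "\<lambda>t. u t - (p * t + q)" "\<lambda>t. u1 t - p" u2 a Q N J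
    proof
      show "J + 2 \<le> N" using * N by (simp add: algebra_simps)
      show "4 \<le> J" using * N by linarith
      show "continuous_on {0..1} (\<lambda>t. u t - (p * t + q))" by (intro continuous_intros u)
      show "\<bar>u 0 - (p * 0 + q)\<bar> \<le> M" using u pq by (auto simp: M_def)
      fix x :: real assume x: "0 < x" "x < 1"
      show "((\<lambda>t. u t - (p * t + q)) has_real_derivative u1 x - p) (at x)"
        using x by (auto intro!: derivative_eq_intros u)
      show "((\<lambda>t. u1 t - p) has_real_derivative u2 x) (at x)"
        using x by (auto intro!: derivative_eq_intros u)
      show "- eps * u2 x - b x * (u1 x - p) + c x * (u x - (p * x + q)) = 0"
        using u(6)[of x] reduced[of x] x by (simp add: algebra_simps)
    qed (use * assms(8-10) u pq in auto)
    \<comment> \<open>Subtracting the same line from \<open>u\<close> and from \<open>U\<close>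
      leaves the nodal error unchanged and makes the discrete equation homogeneous.\<close>
    define V where "V j = U j - (p * x j + q)" for j
    have "ASI_op eps b c x V j = 0" if j: "0 < j" "j < N" for j
    proof -
      have "ASI_op eps b c x V j = ASI_op eps b c x U j - ASI_op eps b c x (\<lambda>j. p * x j + q) j"
        unfolding V_def by (rule ASI_op_diff)
      also have "ASI_op eps b c x U j = f (x j)" using * j by (simp add: x_def)
      also have "ASI_op eps b c x (\<lambda>j. p * x j + q) j = - b (x j) * p + c (x j) * (p * x j + q)"
        using x_strict_mono[of "j - 1" j] x_strict_mono[of j "j + 1"] j by (intro ASI_op_affine) auto
      finally show ?thesis using reduced[of "x j"] x_inside[OF j] by simp
    qed
    then have "\<bar>u (x i) - (p * x i + q) - V i\<bar> \<le> D * (eps * L\<^sup>2 / (real N)\<^sup>2 + eps\<^sup>2 / real N)"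
      unfolding D_def w_def[symmetric]
    proof (intro error_bound i)
      show "V 0 = u 0 - (p * 0 + q)" "V N = u 1 - (p * 1 + q)"
        using * u x_ends by (simp_all add: V_def)
    qed
    also have "\<dots> \<le> D * (2 * max (eps * \<bar>ln eps\<bar> ^ 3 / real N ^ 2) (eps / real N ^ 2 + eps\<^sup>2 / real N))"
    proof (intro mult_left_mono)
      have ln: "\<bar>ln eps\<bar> = L" using * L_pos by (simp add: L_def ln_div)
      \<comment> \<open>The case split at \<open>L = 1\<close> trades the square of the logarithm
        for its cube or for 1. The factor 2 then covers the sum of this term and
        \<open>eps^2 / N\<close>.\<close>
      have "eps * L\<^sup>2 / (real N)\<^sup>2 \<le> max (eps * L ^ 3 / (real N)\<^sup>2) (eps / (real N)\<^sup>2)"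
      proof (cases "1 \<le> L")
        case True
        then have "L\<^sup>2 \<le> L ^ 3" by (intro power_increasing) auto
        then have "eps * L\<^sup>2 / (real N)\<^sup>2 \<le> eps * L ^ 3 / (real N)\<^sup>2"
          using * by (intro divide_right_mono mult_left_mono) auto
        then show ?thesis by simp
      next
        case False
        then have "L\<^sup>2 \<le> 1" using L_pos by (intro power_le_one) auto
        then have "eps * L\<^sup>2 / (real N)\<^sup>2 \<le> eps * 1 / (real N)\<^sup>2"
          using * by (intro divide_right_mono mult_left_mono) auto
        then show ?thesis by simp
      qed
      moreover have "0 \<le> eps / (real N)\<^sup>2" "0 \<le> eps\<^sup>2 / real N" using * by auto
      moreover have "X + Y \<le> 2 * max A (B + Y)" if "X \<le> max A B" "0 \<le> B" "0 \<le> Y" for X Y A B :: real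
        using that by (simp add: max_def split: if_splits)
      ultimately show "eps * L\<^sup>2 / (real N)\<^sup>2 + eps\<^sup>2 / real N
          \<le> 2 * max (eps * \<bar>ln eps\<bar> ^ 3 / real N ^ 2) (eps / real N ^ 2 + eps\<^sup>2 / real N)"
        unfolding ln by blast
      show "0 \<le> D"
        unfolding D_def w_def[symmetric] C_error_def C_source_def using error_constants_nonneg params Q
        by (intro add_nonneg_nonneg mult_nonneg_nonneg divide_nonneg_nonneg) auto
    qed
    finally show "\<bar>u (mesh_pt a eps \<beta> (1 / eps) N J i) - U (i)\<bar>
        \<le> 2 * D * max (eps * \<bar>ln eps\<bar> ^ 3 / real N ^ 2) (eps / real N ^ 2 + eps\<^sup>2 / real N)"
      by (simp add: V_def x_def)
  qed
qed

end
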